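(* Let $a,b,c$ be real constants and let $\Gamma\subset\mathbb{R}^2$ be a connected non-singular real-analytic curve. Let $U\subset\mathbb{R}^2$ be a reflection neighbourhood for $\Gamma$ with reflection $R$ and components $U_1,U_2$ of $U\setminus\Gamma$ (see context). Suppose that point-to-point reflection holds for the equation $$\Delta_{x,y}u+a\frac{\partial u}{\partial x}+b\frac{\partial u}{\partial y}+cu=0$$ with respect to $\Gamma$, i.e. there is a function $\kappa:U\setminus\Gamma\to\mathbb{C}$ such that $u(P)=\kappa(P)\,u(R(P))$ for every $P\in U\setminus\Gamma$ and every solution $u$ of the equation in $U$ vanishing on $\Gamma\cap U$. Then at least one of the following holds: (i) $\Gamma$ is a line (i.e. it is contained in a straight line); (ii) $a^2+b^2-4c=0$.
   Context: Let $\Gamma=\{f(x,y)=0\}$ with $f$ real-analytic and $\operatorname{grad} f\neq0$ on $\Gamma$. With $z=x+iy$, $\zeta=x-iy$, the complexified equation $f\left(\frac{z+\zeta}{2},\frac{z-\zeta}{2i}\right)=0$ can be solved near $\Gamma$ as $\zeta=S(z)$ with $S$ holomorphic; $S$ is the Schwarz function of $\Gamma$. The reflection is $R(x,y)=R(z)=\overline{S(z)}$, where $(x,y)$ is identified with $z=x+iy$. Reflection neighbourhood: a simply connected neighbourhood $U\subset\mathbb{R}^2\cong\mathbb{C}$ of a point of $\Gamma$ such that $\Gamma\cap U$ is connected and divides $U$ into two components $U_1,U_2$, $S$ is holomorphic on $U$, and $R:U\to U$ is an anti-conformal involution that is the identity on $\Gamma\cap U$ and interchanges $U_1$ and $U_2$.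 *)

theory Defs
  imports "HOL-Analysis.Analysis"
begin

text \<open>The plane \<open>\<real>\<^sup>2\<close> is identified with the type \<^typ>\<open>complex\<close>, \<open>(x, y)\<close> being \<open>z = x + iy\<close>.\<close>

definition pdx :: "(complex \<Rightarrow> 'a::real_normed_vector) \<Rightarrow> complex \<Rightarrow> 'a" where
  "pdx u z = vector_derivative (\<lambda>t::real. u (z + of_real t)) (at 0)"

definition pdy :: "(complex \<Rightarrow> 'a::real_normed_vector) \<Rightarrow> complex \<Rightarrow> 'a" where
  "pdy u z = vector_derivative (\<lambda>t::real. u (z + \<i> * of_real t)) (at 0)"

definition laplacian :: "(complex \<Rightarrow> 'a::real_normed_vector) \<Rightarrow> complex \<Rightarrow> 'a" where
  "laplacian u z = pdx (pdx u) z + pdy (pdy u) z"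

definition C1_on :: "(complex \<Rightarrow> 'a::real_normed_vector) \<Rightarrow> complex set \<Rightarrow> bool" where
  "C1_on u U \<longleftrightarrow>
     continuous_on U u \<and>
     (\<forall>z\<in>U. (\<lambda>t::real. u (z + of_real t)) differentiable (at 0)) \<and>
     (\<forall>z\<in>U. (\<lambda>t::real. u (z + \<i> * of_real t)) differentiable (at 0)) \<and>
     continuous_on U (pdx u) \<and> continuous_on U (pdy u)"

definition C2_on :: "(complex \<Rightarrow> 'a::real_normed_vector) \<Rightarrow> complex set \<Rightarrow> bool" where
  "C2_on u U \<longleftrightarrow> C1_on u U \<and> C1_on (pdx u) U \<and> C1_on (pdy u) U"

definition pde_solution ::
  "real \<Rightarrow> real \<Rightarrow> real \<Rightarrow> complex set \<Rightarrow> (complex \<Rightarrow> complex) \<Rightarrow> bool" where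
  "pde_solution a b c U u \<longleftrightarrow>
     C2_on u U \<and>
     (\<forall>z\<in>U. laplacian u z + of_real a * pdx u z + of_real b * pdy u z + of_real c * u z = 0)"

text \<open>Real power series in two variables, converging unconditionally in a neighbourhood of \<open>p\<close>.\<close>

definition has_expansion_at ::
  "(complex \<Rightarrow> real) \<Rightarrow> (nat \<Rightarrow> nat \<Rightarrow> real) \<Rightarrow> complex \<Rightarrow> bool" where
  "has_expansion_at f C p \<longleftrightarrow>
     (\<forall>\<^sub>F q in nhds p.
        ((\<lambda>(i, j). C i j * (Re q - Re p) ^ i * (Im q - Im p) ^ j) has_sum f q) UNIV)"

definition real_analytic_on :: "(complex \<Rightarrow> real) \<Rightarrow> complex set \<Rightarrow> bool" where
  "real_analytic_on f W \<longleftrightarrow> (\<forall>p\<in>W. \<exists>C. has_expansion_at f C p)"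

text \<open>The defining function \<open>f\<close> is only required to live on an open set \<open>W\<close>
  (possibly the whole plane), so that arcs are covered.\<close>

definition nonsingular_analytic_curve ::
  "(complex \<Rightarrow> real) \<Rightarrow> complex set \<Rightarrow> complex set \<Rightarrow> bool" where
  "nonsingular_analytic_curve f W \<Gamma> \<longleftrightarrow>
     open W \<and> real_analytic_on f W \<and> \<Gamma> = {z \<in> W. f z = 0} \<and>
     (\<forall>z\<in>\<Gamma>. (pdx f z, pdy f z) \<noteq> (0, 0))"

text \<open>\<open>S\<close> is the Schwarz function on \<open>U\<close>. Near a point \<open>p\<close> of the curve, the complexification of
  \<open>f\<close> is the sum of its Taylor series at \<open>p\<close> with complex arguments, and
  \<open>\<zeta> = S z\<close> solves \<open>f ((z + \<zeta>) / 2, (z - \<zeta>) / (2 i)) = 0\<close>. The condition \<open>S p = cnj p\<close> selects the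
  branch: \<open>\<zeta> = x - iy\<close> at the real points of the complexified curve.\<close>

definition schwarz_function ::
  "(complex \<Rightarrow> real) \<Rightarrow> complex set \<Rightarrow> complex set \<Rightarrow> (complex \<Rightarrow> complex) \<Rightarrow> bool" where
  "schwarz_function f \<Gamma> U S \<longleftrightarrow>
     S holomorphic_on U \<and>
     (\<forall>p\<in>\<Gamma> \<inter> U. S p = cnj p \<and>
        (\<exists>C. has_expansion_at f C p \<and>
           (\<forall>\<^sub>F z in nhds p.
              ((\<lambda>(i, j). of_real (C i j) * ((z + S z) / 2 - of_real (Re p)) ^ i
                   * ((z - S z) / (2 * \<i>) - of_real (Im p)) ^ j) has_sum 0) UNIV)))"

definition anticonformal_on :: "(complex \<Rightarrow> complex) \<Rightarrow> complex set \<Rightarrow> bool" where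
  "anticonformal_on R U \<longleftrightarrow>
     (\<lambda>z. cnj (R z)) holomorphic_on U \<and> (\<forall>z\<in>U. deriv (\<lambda>w. cnj (R w)) z \<noteq> 0)"

definition reflection_neighbourhood ::
  "(complex \<Rightarrow> real) \<Rightarrow> complex set \<Rightarrow> complex set \<Rightarrow> complex set \<Rightarrow> complex set
    \<Rightarrow> (complex \<Rightarrow> complex) \<Rightarrow> (complex \<Rightarrow> complex) \<Rightarrow> bool" where
  "reflection_neighbourhood f \<Gamma> U U\<^sub>1 U\<^sub>2 S R \<longleftrightarrow>
     open U \<and> simply_connected U \<and> \<Gamma> \<inter> U \<noteq> {} \<and> connected (\<Gamma> \<inter> U) \<and>
     U\<^sub>1 \<noteq> U\<^sub>2 \<and> components (U - \<Gamma>) = {U\<^sub>1, U\<^sub>2} \<and>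
     schwarz_function f \<Gamma> U S \<and> (\<forall>z\<in>U. R z = cnj (S z)) \<and>
     anticonformal_on R U \<and> (\<forall>z\<in>U. R z \<in> U \<and> R (R z) = z) \<and>
     (\<forall>z\<in>\<Gamma> \<inter> U. R z = z) \<and> R ` U\<^sub>1 = U\<^sub>2 \<and> R ` U\<^sub>2 = U\<^sub>1"

definition point_to_point_reflection ::
  "real \<Rightarrow> real \<Rightarrow> real \<Rightarrow> complex set \<Rightarrow> complex set \<Rightarrow> (complex \<Rightarrow> complex) \<Rightarrow> bool" where
  "point_to_point_reflection a b c \<Gamma> U R \<longleftrightarrow>
     (\<exists>\<kappa> :: complex \<Rightarrow> complex. \<forall>P\<in>U - \<Gamma>. \<forall>u.
        pde_solution a b c U u \<and> (\<forall>z\<in>\<Gamma> \<inter> U. u z = 0) \<longrightarrow> u P = \<kappa> P * u (R P))"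

end

theory Submission
  imports Defs "HOL-Complex_Analysis.Complex_Analysis"
begin

text \<open>
  The substitution \<open>u = exp (- (a x + b y) / 2) v\<close> turns the equation into
  \<open>\<partial>\<^sub>z \<partial>\<^sub>\<zeta> v = \<mu> v\<close> with \<open>\<zeta> = cnj z\<close> and \<open>16 \<mu> = a\<^sup>2 + b\<^sup>2 - 4 c\<close>, whose Riemann function is
  \<open>G ((z - t) (\<zeta> - \<tau>))\<close> with \<open>G w = (\<Sum>n. (\<mu> w)\<^sup>n / (n!)\<^sup>2)\<close>. Hence every entire density \<open>\<Phi>\<close> gives the
  solution \<open>v z = \<integral> \<Phi> t G ((z - t) (cnj z - S t)) dt\<close>, integrated from \<open>R z\<close> to \<open>z\<close>, which
  is defined on all of the simply connected \<open>U\<close> and vanishes on the curve.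
  Inserting these solutions into \<open>u P = \<kappa> P u Q\<close>, \<open>Q = R P\<close>, and varying \<open>\<Phi>\<close>, the Weierstrass approximation
  theorem on the segment from \<open>Q\<close> to \<open>P\<close> gives
  \<open>G ((P - t) (S Q - S t)) = G ((Q - t) (S P - S t))\<close> for \<open>t\<close> on the segment. If \<open>\<mu> \<noteq> 0\<close>, then \<open>G\<close> is injective
  near \<open>0\<close>, so the arguments agree, and this is an affine equation for \<open>S t\<close>. So \<open>S\<close> is affine near a
  point of the curve, the curve is straight there, and by analyticity it is
  straight everywhere.
\<close>

section \<open>Real-analytic curves containing a line segment\<close>

lemma has_sum_diff:
  fixes f g :: "'a \<Rightarrow> 'b::real_normed_vector"
  assumes "(f has_sum s) A" "(g has_sum t) A"
  shows "((\<lambda>x. f x - g x) has_sum (s - t)) A"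
  using has_sum_add[OF assms(1), of "\<lambda>x. - g x" "- t"] assms(2) by (simp add: has_sum_uminus)

text \<open>Telescoping by induction on the exponent. The factor \<open>\<rho>\<close> on the left
  replaces the usual exponent \<open>k - 1\<close> on the right, so that \<open>k = 0\<close> and
  \<open>\<rho> = 0\<close> need no separate treatment.\<close>

lemma power_diff_le:
  fixes x x' \<rho> :: real
  assumes "\<bar>x\<bar> \<le> \<rho>" "\<bar>x'\<bar> \<le> \<rho>"
  shows "\<rho> * \<bar>x ^ k - x' ^ k\<bar> \<le> real k * \<rho> ^ k * \<bar>x - x'\<bar>"
proof (induction k)
  case (Suc k)
  have r: "0 \<le> \<rho>" using assms(1) by linarith
  have "x ^ Suc k - x' ^ Suc k = x * (x ^ k - x' ^ k) + (x - x') * x' ^ k"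
    by (simp add: algebra_simps)
  then have "\<bar>x ^ Suc k - x' ^ Suc k\<bar> \<le> \<bar>x\<bar> * \<bar>x ^ k - x' ^ k\<bar> + \<bar>x - x'\<bar> * \<bar>x'\<bar> ^ k"
    by (metis abs_mult abs_triangle_ineq power_abs)
  also have "\<dots> \<le> \<rho> * \<bar>x ^ k - x' ^ k\<bar> + \<bar>x - x'\<bar> * \<rho> ^ k"
    using assms by (intro add_mono mult_mono power_mono) auto
  also have "\<dots> \<le> real k * \<rho> ^ k * \<bar>x - x'\<bar> + \<bar>x - x'\<bar> * \<rho> ^ k"
    using Suc by simp
  finally have "\<rho> * \<bar>x ^ Suc k - x' ^ Suc k\<bar>
      \<le> \<rho> * (real k * \<rho> ^ k * \<bar>x - x'\<bar> + \<bar>x - x'\<bar> * \<rho> ^ k)"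
    using r mult_left_mono by blast
  then show ?case by (simp add: algebra_simps)
qed simp

lemma monomial_diff_le:
  fixes x x' y y' \<rho> m :: real
  assumes "\<bar>x\<bar> \<le> \<rho>" "\<bar>x'\<bar> \<le> \<rho>" "\<bar>y\<bar> \<le> \<rho>" "\<bar>y'\<bar> \<le> \<rho>" "\<bar>x - x'\<bar> \<le> m" "\<bar>y - y'\<bar> \<le> m"
  shows "\<rho> * \<bar>x ^ i * y ^ j - x' ^ i * y' ^ j\<bar> \<le> real (i + j) * \<rho> ^ (i + j) * m"
proof -
  have r: "0 \<le> \<rho>" using assms(1) by linarith
  have "x ^ i * y ^ j - x' ^ i * y' ^ j = (x ^ i - x' ^ i) * y ^ j + x' ^ i * (y ^ j - y' ^ j)"
    by (simp add: algebra_simps)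
  then have "\<bar>x ^ i * y ^ j - x' ^ i * y' ^ j\<bar>
      \<le> \<bar>x ^ i - x' ^ i\<bar> * \<bar>y\<bar> ^ j + \<bar>x'\<bar> ^ i * \<bar>y ^ j - y' ^ j\<bar>"
    by (metis abs_mult abs_triangle_ineq power_abs)
  also have "\<dots> \<le> \<bar>x ^ i - x' ^ i\<bar> * \<rho> ^ j + \<rho> ^ i * \<bar>y ^ j - y' ^ j\<bar>"
    using assms r by (intro add_mono mult_mono power_mono) auto
  finally have "\<rho> * \<bar>x ^ i * y ^ j - x' ^ i * y' ^ j\<bar>
      \<le> \<rho> * (\<bar>x ^ i - x' ^ i\<bar> * \<rho> ^ j + \<rho> ^ i * \<bar>y ^ j - y' ^ j\<bar>)"
    using r mult_left_mono by blast
  also have "\<dots> = (\<rho> * \<bar>x ^ i - x' ^ i\<bar>) * \<rho> ^ j + \<rho> ^ i * (\<rho> * \<bar>y ^ j - y' ^ j\<bar>)"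
    by (simp add: algebra_simps)
  also have "\<dots> \<le> (real i * \<rho> ^ i * m) * \<rho> ^ j + \<rho> ^ i * (real j * \<rho> ^ j * m)"
  proof (intro add_mono mult_right_mono mult_left_mono)
    show "\<rho> * \<bar>x ^ i - x' ^ i\<bar> \<le> real i * \<rho> ^ i * m"
      using power_diff_le[OF assms(1,2), of i] assms(5) r
      by (smt (verit) mult_left_mono mult_nonneg_nonneg of_nat_0_le_iff zero_le_power)
    show "\<rho> * \<bar>y ^ j - y' ^ j\<bar> \<le> real j * \<rho> ^ j * m"
      using power_diff_le[OF assms(3,4), of j] assms(6) r
      by (smt (verit) mult_left_mono mult_nonneg_nonneg of_nat_0_le_iff zero_le_power)
  qed (use r in auto)
  also have "\<dots> = real (i + j) * \<rho> ^ (i + j) * m"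
    by (simp add: algebra_simps power_add)
  finally show ?thesis .
qed

text \<open>The factor \<open>n\<close> comes from differentiating a term of degree
  \<open>n\<close>. Halving the radius absorbs it, and the exponent \<open>n - 2\<close> is what
  remains once two powers of the distance have been set aside.\<close>

lemma nat_mult_half_power_le:
  assumes "n \<ge> 2"
  shows "real n * (1/2) ^ (n - 2) \<le> 2"
proof -
  have "real (m + 2) * (1/2) ^ m \<le> 2" for m
  proof (induction m)
    case (Suc m)
    have "real (Suc m + 2) \<le> 2 * real (m + 2)" by simp
    then have "real (Suc m + 2) * (1/2) ^ Suc m \<le> 2 * real (m + 2) * (1/2) ^ Suc m"
      by (rule mult_right_mono) simp
    also have "\<dots> = real (m + 2) * (1/2) ^ m" by simp
    finally show ?case using Suc by linarith
  qed simp
  from this[of "n - 2"] show ?thesis using assms by simp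
qed

text \<open>The terms of degree at least two have Lipschitz constant of order \<open>d\<close> on
  the disc of radius \<open>d\<close>, by comparison with the absolutely convergent series at a
  fixed radius. Both points vary: \<open>nonsingular_on_line\<close> compares zeros of
  \<open>f\<close> neither of which is the centre.\<close>

lemma expansion_strictly_differentiable:
  assumes "has_expansion_at f C p" "e > 0"
  shows "\<forall>\<^sub>F d in at_right 0. \<forall>x y. dist x p \<le> d \<and> dist y p \<le> d \<longrightarrow>
           \<bar>f x - f y - (C 1 0 * Re (x - y) + C 0 1 * Im (x - y))\<bar> \<le> e * dist x y"
proof -
  obtain \<delta> where \<delta>: "\<delta> > 0" and hs: "\<And>q. dist q p < \<delta> \<Longrightarrow>
      ((\<lambda>(i, j). C i j * (Re q - Re p) ^ i * (Im q - Im p) ^ j) has_sum f q) UNIV"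
    using assms(1) unfolding has_expansion_at_def eventually_nhds_metric by blast
  \<comment> \<open>The diagonal point \<open>p + Complex r r\<close> has distance at most
    \<open>2 * r\<close> from \<open>p\<close>, so the series converges there. Its convergence is
    absolute and provides the majorant \<open>A\<close>.\<close>
  define r where "r = \<delta> / 3"
  have r: "r > 0" using \<delta> by (simp add: r_def)
  define A where "A = (\<lambda>(i, j). \<bar>C i j\<bar> * r ^ (i + j))"
  have "dist (p + Complex r r) p < \<delta>"
  proof -
    have "dist (p + Complex r r) p \<le> \<bar>r\<bar> + \<bar>r\<bar>"
      unfolding dist_norm using cmod_le[of "Complex r r"] by simp
    then show ?thesis using \<delta> by (simp add: r_def)
  qed
  from has_sum_imp_summable[OF hs[OF this]]
  have "(\<lambda>(i, j). C i j * r ^ i * r ^ j) summable_on UNIV" by simp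
  then have "(\<lambda>x. norm (case x of (i, j) \<Rightarrow> C i j * r ^ i * r ^ j)) summable_on UNIV"
    by (rule summable_on_iff_abs_summable_on_real[THEN iffD1])
  moreover have "(\<lambda>x. norm (case x of (i, j) \<Rightarrow> C i j * r ^ i * r ^ j)) = A"
    using r by (auto simp: A_def abs_mult power_add fun_eq_iff)
  ultimately have sA: "A summable_on UNIV" by simp
  define M where "M = infsum A UNIV"
  have M: "(A has_sum M) UNIV" using sA M_def by (simp add: has_sum_infsum)
  have M0: "M \<ge> 0" unfolding M_def using r by (intro infsum_nonneg) (auto simp: A_def)
  \<comment> \<open>The first bound gives powers of one half against the radius \<open>r\<close>;
    the second makes the final Lipschitz constant \<open>2 * d * M / r\<^sup>2\<close> at most
    \<open>e\<close>.\<close>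
  define d0 where "d0 = min (r / 2) (e * r\<^sup>2 / (2 * (M + 1)))"
  have d0: "d0 > 0" using r M0 assms(2) by (simp add: d0_def)
  have main: "\<bar>f x - f y - (C 1 0 * Re (x - y) + C 0 1 * Im (x - y))\<bar> \<le> e * dist x y"
    if d: "0 < d" "d \<le> d0" and x: "dist x p \<le> d" and y: "dist y p \<le> d" for d x y
  proof -
    define X Y X' Y' where "X = Re x - Re p" and "Y = Im x - Im p" and "X' = Re y - Re p" and "Y' = Im y - Im p"
    have b: "\<bar>X\<bar> \<le> d" "\<bar>Y\<bar> \<le> d" "\<bar>X'\<bar> \<le> d" "\<bar>Y'\<bar> \<le> d"
      using x y abs_Re_le_cmod[of "x - p"] abs_Im_le_cmod[of "x - p"] abs_Re_le_cmod[of "y - p"] abs_Im_le_cmod[of "y - p"]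
      by (auto simp: X_def Y_def X'_def Y'_def dist_norm)
    have b': "\<bar>X - X'\<bar> \<le> dist x y" "\<bar>Y - Y'\<bar> \<le> dist x y"
      using abs_Re_le_cmod[of "x - y"] abs_Im_le_cmod[of "x - y"]
      by (auto simp: X_def Y_def X'_def Y'_def dist_norm)
    have dr: "d \<le> r / 2" and dM: "d * (2 * (M + 1)) \<le> e * r\<^sup>2"
      using d M0 by (auto simp: d0_def field_simps)
    have "dist x p < \<delta>" "dist y p < \<delta>" using x y dr r by (auto simp: r_def)
    from has_sum_diff[OF hs[OF this(1)] hs[OF this(2)]]
    have s1: "((\<lambda>(i, j). C i j * (X ^ i * Y ^ j - X' ^ i * Y' ^ j)) has_sum (f x - f y)) UNIV"
      by (simp add: X_def Y_def X'_def Y'_def case_prod_unfold algebra_simps)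
    \<comment> \<open>The linear part as a family over all index pairs. The constant term already
      cancels in the difference, so \<open>g\<close> carries only degrees two and higher.\<close>
    define l where "l = (\<lambda>(i, j). if (i, j) \<in> {(1::nat, 0::nat), (0, 1)} then C i j * (X ^ i * Y ^ j - X' ^ i * Y' ^ j) else 0)"
    have s2: "(l has_sum (C 1 0 * Re (x - y) + C 0 1 * Im (x - y))) UNIV"
      by (rule has_sum_finite_neutralI[where B = "{(1, 0), (0, 1)}"])
         (auto simp: l_def X_def Y_def X'_def Y'_def algebra_simps split: if_splits)
    define g where "g = (\<lambda>ij. (case ij of (i, j) \<Rightarrow> C i j * (X ^ i * Y ^ j - X' ^ i * Y' ^ j)) - l ij)"
    have s3: "(g has_sum (f x - f y - (C 1 0 * Re (x - y) + C 0 1 * Im (x - y)))) UNIV"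
      unfolding g_def by (rule has_sum_diff[OF s1 s2])
    define K where "K = 2 * d / r\<^sup>2 * dist x y"
    have K0: "K \<ge> 0" using d by (simp add: K_def)
    have gb: "norm (g ij) \<le> K * A ij" for ij
    proof -
      obtain i j where ij: "ij = (i, j)" by fastforce
      show ?thesis
      proof (cases "i + j \<ge> 2")
        case True
        define n where "n = i + j"
        have n: "n \<ge> 2" using True n_def by simp
        then have n2: "n = Suc (Suc (n - 2))" by simp
        have "d * \<bar>X ^ i * Y ^ j - X' ^ i * Y' ^ j\<bar> \<le> real n * d ^ n * dist x y"
          unfolding n_def by (rule monomial_diff_le) (use b b' in auto)
        also have "\<dots> = d * (d * (real n * d ^ (n - 2)) * dist x y)"
        proof -
          have "d ^ n = d * (d * d ^ (n - 2))" by (metis n2 power_Suc)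
          then show ?thesis by simp
        qed
        finally have "\<bar>X ^ i * Y ^ j - X' ^ i * Y' ^ j\<bar> \<le> d * (real n * d ^ (n - 2)) * dist x y"
          using d by simp
        also have "\<dots> \<le> d * (2 * r ^ (n - 2)) * dist x y"
        proof -
          have "real n * d ^ (n - 2) \<le> real n * (r / 2) ^ (n - 2)"
            using d dr by (intro mult_left_mono power_mono) auto
          also have "\<dots> = (real n * (1/2) ^ (n - 2)) * r ^ (n - 2)"
            by (simp add: power_divide)
          also have "\<dots> \<le> 2 * r ^ (n - 2)"
            using nat_mult_half_power_le[OF n] r by (intro mult_right_mono) auto
          finally show ?thesis using d by (intro mult_right_mono mult_left_mono) auto
        qed
        also have "\<dots> = K * r ^ n"
        proof -
          have "r ^ n = r * (r * r ^ (n - 2))" by (metis n2 power_Suc)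
          then show ?thesis using r by (simp add: K_def power2_eq_square)
        qed
        finally have "\<bar>X ^ i * Y ^ j - X' ^ i * Y' ^ j\<bar> \<le> K * r ^ n" .
        then have "\<bar>C i j\<bar> * \<bar>X ^ i * Y ^ j - X' ^ i * Y' ^ j\<bar> \<le> \<bar>C i j\<bar> * (K * r ^ n)"
          by (intro mult_left_mono) auto
        moreover have "l (i, j) = 0" using True by (auto simp: l_def)
        ultimately show ?thesis by (simp add: ij g_def A_def abs_mult n_def mult_ac)
      next
        case False
        then consider "i = 0" "j = 0" | "i = 1" "j = 0" | "i = 0" "j = 1" by linarith
        then have "g ij = 0" by cases (simp_all add: ij g_def l_def)
        then show ?thesis using K0 r by (auto simp: A_def ij)
      qed
    qed
    have sg: "(\<lambda>ij. norm (g ij)) summable_on UNIV"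
      by (rule summable_on_iff_abs_summable_on_real[THEN iffD1, OF has_sum_imp_summable[OF s3]])
    have "norm (f x - f y - (C 1 0 * Re (x - y) + C 0 1 * Im (x - y))) \<le> infsum (\<lambda>ij. norm (g ij)) UNIV"
      using norm_has_sum_bound[OF has_sum_infsum[OF sg] s3] .
    also have "\<dots> \<le> K * M"
      using has_sum_mono[OF has_sum_infsum[OF sg] has_sum_cmult_right[OF M, of K]] gb by blast
    also have "\<dots> \<le> e * dist x y"
    proof -
      have "2 * d * M \<le> e * r\<^sup>2" using dM d by (simp add: algebra_simps)
      then have "2 * d * M * dist x y \<le> e * r\<^sup>2 * dist x y" by (rule mult_right_mono) simp
      then show ?thesis using r by (simp add: K_def field_simps)
    qed
    finally show ?thesis by simp
  qed
  show ?thesis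
    unfolding eventually_at_right_field
  proof (intro exI[of _ d0] conjI d0 allI impI)
    fix d x y assume "0 < d" "d < d0" "dist x p \<le> d \<and> dist y p \<le> d"
    then show "\<bar>f x - f y - (C 1 0 * Re (x - y) + C 0 1 * Im (x - y))\<bar> \<le> e * dist x y"
      using main[of d x y] by simp
  qed
qed

text \<open>Identifies the gradient in the nonsingularity condition with the linear coefficients.
  Directions \<open>1\<close> and \<open>\<i>\<close> are handled together by a general unit vector
  \<open>w\<close>.\<close>

lemma expansion_pdx_pdy:
  assumes "has_expansion_at f C p"
  shows "pdx f p = C 1 0" "pdy f p = C 0 1"
proof -
  have *: "((\<lambda>t::real. f (p + w * of_real t)) has_vector_derivative (C 1 0 * Re w + C 0 1 * Im w)) (at 0)"
    if w: "norm w = 1" for w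
  proof -
    have "((\<lambda>t::real. f (p + w * of_real t)) has_derivative (\<lambda>t. t * (C 1 0 * Re w + C 0 1 * Im w))) (at 0)"
      unfolding has_derivative_at_alt
    proof (intro conjI allI impI)
      fix e :: real assume "e > 0"
      then obtain d where d: "d > 0" and H: "\<And>x y. dist x p \<le> d \<Longrightarrow> dist y p \<le> d \<Longrightarrow>
           \<bar>f x - f y - (C 1 0 * Re (x - y) + C 0 1 * Im (x - y))\<bar> \<le> e * dist x y"
        using expansion_strictly_differentiable[OF assms, of e]
        unfolding eventually_at_right_field by (meson dense)
      show "\<exists>d>0. \<forall>y. norm (y - 0) < d \<longrightarrow> norm (f (p + w * of_real y) - f (p + w * of_real 0) - (y - 0) * (C 1 0 * Re w + C 0 1 * Im w)) \<le> e * norm (y - 0)"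
      proof (intro exI[of _ d] conjI d allI impI)
        fix t :: real assume "norm (t - 0) < d"
        then show "norm (f (p + w * of_real t) - f (p + w * of_real 0) - (t - 0) * (C 1 0 * Re w + C 0 1 * Im w)) \<le> e * norm (t - 0)"
          using H[of "p + w * of_real t" p] d w by (simp add: dist_norm norm_mult algebra_simps)
      qed
    qed (rule bounded_linear_mult_left)
    then show ?thesis by (simp add: has_vector_derivative_def)
  qed
  show "pdx f p = C 1 0" using vector_derivative_at[OF *[of 1]] by (simp add: pdx_def)
  show "pdy f p = C 0 1" using vector_derivative_at[OF *[of \<i>]] by (simp add: pdy_def)
qed

section \<open>Zeros of a real-analytic function on a line\<close>

text \<open>Unconditional convergence allows grouping the double series by total degree, which
  leaves a power series in the line parameter.\<close>

lemma expansion_along_line: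
  assumes "has_expansion_at f C p"
  shows "\<exists>a. \<forall>\<^sub>F s in nhds 0. (\<lambda>n. a n * s ^ n) sums f (p + of_real s * \<tau>)"
proof -
  define a where "a = (\<lambda>n. \<Sum>i\<le>n. C i (n - i) * Re \<tau> ^ i * Im \<tau> ^ (n - i))"
  have ev: "\<forall>\<^sub>F s::real in nhds 0. ((\<lambda>(i, j). C i j * (Re (p + of_real s * \<tau>) - Re p) ^ i * (Im (p + of_real s * \<tau>) - Im p) ^ j) has_sum f (p + of_real s * \<tau>)) UNIV"
  proof -
    obtain d where d: "d > 0" and H: "\<And>q. dist q p < d \<Longrightarrow>
        ((\<lambda>(i, j). C i j * (Re q - Re p) ^ i * (Im q - Im p) ^ j) has_sum f q) UNIV"
      using assms unfolding has_expansion_at_def eventually_nhds_metric by blast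
    have "dist (p + of_real s * \<tau>) p < d" if "dist s 0 < d / (norm \<tau> + 1)" for s :: real
    proof -
      have "\<bar>s\<bar> * norm \<tau> \<le> \<bar>s\<bar> * (norm \<tau> + 1)" by (simp add: mult_left_mono)
      also have "\<dots> < d" using that by (simp add: dist_norm pos_less_divide_eq add_nonneg_pos)
      finally show ?thesis by (simp add: dist_norm norm_mult)
    qed
    moreover have "d / (norm \<tau> + 1) > 0" using d by (simp add: add_nonneg_pos)
    ultimately show ?thesis unfolding eventually_nhds_metric using H by blast
  qed
  have sums: "(\<lambda>n. a n * s ^ n) sums f (p + of_real s * \<tau>)"
    if "((\<lambda>(i, j). C i j * (Re (p + of_real s * \<tau>) - Re p) ^ i * (Im (p + of_real s * \<tau>) - Im p) ^ j) has_sum f (p + of_real s * \<tau>)) UNIV" for s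
  proof -
    have 1: "((\<lambda>(n, i). C i (n - i) * (s * Re \<tau>) ^ i * (s * Im \<tau>) ^ (n - i)) has_sum f (p + of_real s * \<tau>)) (Sigma UNIV (\<lambda>n. {..n}))"
    \<comment> \<open>The pair \<open>(i, j)\<close> is recorded as its total degree
      \<open>i + j\<close> together with \<open>i\<close>, which makes every inner sum
      finite.\<close>
    proof (rule has_sum_reindex_bij_witness[where j = "\<lambda>(n, i). (i, n - i)" and i = "\<lambda>(i, j). (i + j, i)"
            and h = "\<lambda>(i, j). C i j * (s * Re \<tau>) ^ i * (s * Im \<tau>) ^ j", THEN iffD2])
      show "((\<lambda>(i, j). C i j * (s * Re \<tau>) ^ i * (s * Im \<tau>) ^ j) has_sum f (p + of_real s * \<tau>)) UNIV"
        using that by simp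
    qed (auto split: prod.splits)
    have "((\<lambda>n. \<Sum>i\<le>n. C i (n - i) * (s * Re \<tau>) ^ i * (s * Im \<tau>) ^ (n - i)) has_sum f (p + of_real s * \<tau>)) UNIV"
      by (rule has_sum_SigmaD[OF 1]) (simp add: has_sum_finite)
    moreover have "(\<Sum>i\<le>n. C i (n - i) * (s * Re \<tau>) ^ i * (s * Im \<tau>) ^ (n - i)) = a n * s ^ n" for n
      unfolding a_def sum_distrib_right
    proof (rule sum.cong[OF refl])
      fix i assume "i \<in> {..n}"
      then have "s ^ n = s ^ i * s ^ (n - i)" by (simp flip: power_add)
      then show "C i (n - i) * (s * Re \<tau>) ^ i * (s * Im \<tau>) ^ (n - i) = C i (n - i) * Re \<tau> ^ i * Im \<tau> ^ (n - i) * s ^ n"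
        by (simp add: power_mult_distrib)
    qed
    ultimately show ?thesis by (simp add: has_sum_imp_sums)
  qed
  show ?thesis by (intro exI[of _ a] eventually_mono[OF ev] sums)
qed

text \<open>Identity principle in one real variable: a nonzero coefficient would make the zero at
  the origin isolated.\<close>

lemma analytic_zero_along_line:
  assumes "has_expansion_at f C p" and "f p = 0" and "\<exists>\<^sub>F s in at 0. f (p + of_real s * \<tau>) = 0"
  shows "\<forall>\<^sub>F s in nhds 0. f (p + of_real s * \<tau>) = 0"
proof -
  obtain a where a: "\<forall>\<^sub>F s in nhds 0. (\<lambda>n. a n * s ^ n) sums f (p + of_real s * \<tau>)"
    using expansion_along_line[OF assms(1)] by blast
  then obtain r where r: "r > 0" and sm: "\<And>s::real. norm s < r \<Longrightarrow> (\<lambda>n. a n * s ^ n) sums f (p + of_real s * \<tau>)"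
    unfolding eventually_nhds_metric by (auto simp: dist_norm)
  define g where "g = (\<lambda>s::real. f (p + of_real s * \<tau>))"
  have a0: "a 0 = 0"
    using sm[of 0] assms(2) r by simp
  have all0: "a n = 0" for n
  proof (rule ccontr)
    assume nz: "a n \<noteq> 0"
    then have "n > 0" using a0 by (cases n) auto
    have sm': "norm (x - 0) < r \<Longrightarrow> (\<lambda>n. a n * (x - 0) ^ n) sums g x" for x
      using sm[of x] by (simp add: g_def)
    have g00: "g 0 = 0" using assms(2) by (simp add: g_def)
    have "\<exists>s>0. \<forall>z\<in>cball 0 s - {0}. g z \<noteq> 0"
    proof (rule powser_0_nonzero[OF r sm' g00 nz \<open>n > 0\<close>])
      fix s assume "0 < s" and "\<And>z. z \<in> cball 0 s - {0} \<Longrightarrow> g z \<noteq> 0"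
      then show ?thesis by (intro exI[of _ s] conjI ballI)
    qed
    then obtain s where s: "s > 0" "\<And>z. z \<in> cball 0 s - {0} \<Longrightarrow> g z \<noteq> 0"
      by blast
    have "\<forall>\<^sub>F s in at 0. g s \<noteq> 0"
      unfolding eventually_at
    proof (rule exI[of _ s], intro conjI ballI impI)
      fix x :: real assume "x \<noteq> 0 \<and> dist x 0 < s"
      then show "g x \<noteq> 0" by (intro s(2)) (simp add: dist_norm)
    qed (rule s(1))
    then show False using assms(3) by (simp add: g_def frequently_def)
  qed
  show ?thesis
  proof (rule eventually_mono[OF a])
    fix s assume "(\<lambda>n. a n * s ^ n) sums f (p + of_real s * \<tau>)"
    then have "(\<lambda>n. 0) sums f (p + of_real s * \<tau>)" by (simp only: all0 mult_zero_left)
    from sums_unique2[OF this sums_zero] show "f (p + of_real s * \<tau>) = 0" .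
  qed
qed

text \<open>Plays the part of uniqueness in the implicit function theorem. The derivative of
  \<open>f\<close> along the line is zero, so the one across it is not, and strict differentiability
  forbids two zeros close to \<open>q\<close> on a common normal.\<close>

lemma nonsingular_on_line:
  assumes ex: "has_expansion_at f C q" and ns: "(C 1 0, C 0 1) \<noteq> (0, 0)" and \<tau>: "norm \<tau> = 1"
    and line: "\<forall>\<^sub>F s in nhds 0. f (q + of_real s * \<tau>) = 0"
  shows "\<forall>\<^sub>F z in nhds q. f z = 0 \<longrightarrow> (\<exists>s. z = q + of_real s * \<tau>)"
proof -
  define D where "D = (\<lambda>w. C 1 0 * Re w + C 0 1 * Im w)"
  obtain \<epsilon> where \<epsilon>: "\<epsilon> > 0" and z0: "\<And>s. \<bar>s\<bar> < \<epsilon> \<Longrightarrow> f (q + of_real s * \<tau>) = 0"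
    using line unfolding eventually_nhds_metric by (auto simp: dist_norm)
  have strict: "\<exists>d>0. \<forall>x y. dist x q \<le> d \<and> dist y q \<le> d \<longrightarrow> \<bar>f x - f y - D (x - y)\<bar> \<le> e * dist x y"
    if "e > 0" for e
    using expansion_strictly_differentiable[OF ex that] dense
    unfolding eventually_at_right_field D_def by metis
  \<comment> \<open>Both \<open>q\<close> and \<open>q + s * \<tau>\<close> are zeros of
    \<open>f\<close>, so an error of at most half of \<open>\<bar>D \<tau>\<bar>\<close> times the
    distance is contradictory unless \<open>D \<tau>\<close> vanishes.\<close>
  have D\<tau>: "D \<tau> = 0"
  proof (rule ccontr)
    assume nz: "D \<tau> \<noteq> 0"
    then obtain d where d: "d > 0" and H: "\<And>x y. dist x q \<le> d \<Longrightarrow> dist y q \<le> d \<Longrightarrow> \<bar>f x - f y - D (x - y)\<bar> \<le> \<bar>D \<tau>\<bar> / 2 * dist x y"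
      using strict[of "\<bar>D \<tau>\<bar> / 2"] by auto
    define s where "s = min d (\<epsilon> / 2)"
    have s: "0 < s" "s \<le> d" "s < \<epsilon>" using d \<epsilon> by (auto simp: s_def)
    have "D (of_real s * \<tau>) = s * D \<tau>" by (simp add: D_def algebra_simps)
    then have "s * \<bar>D \<tau>\<bar> \<le> \<bar>D \<tau>\<bar> / 2 * s"
      using H[of "q + of_real s * \<tau>" q] s \<tau> z0[of s] z0[of 0] by (simp add: dist_norm norm_mult abs_mult)
    then show False using s nz by (simp add: field_simps)
  qed
  \<comment> \<open>These are the components of the gradient in the orthonormal frame
    \<open>\<tau>\<close>, \<open>\<i> * \<tau>\<close>, so their squares add up to its squared
    length.\<close>
  have "(D \<tau>)\<^sup>2 + (D (\<i> * \<tau>))\<^sup>2 = ((C 1 0)\<^sup>2 + (C 0 1)\<^sup>2) * ((Re \<tau>)\<^sup>2 + (Im \<tau>)\<^sup>2)"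
    by (simp add: D_def power2_eq_square algebra_simps)
  moreover have "(Re \<tau>)\<^sup>2 + (Im \<tau>)\<^sup>2 = 1" using \<tau> cmod_power2[of \<tau>] by simp
  ultimately have nz: "D (\<i> * \<tau>) \<noteq> 0" using ns D\<tau> by auto
  then obtain d where d: "d > 0" and H: "\<And>x y. dist x q \<le> d \<Longrightarrow> dist y q \<le> d \<Longrightarrow> \<bar>f x - f y - D (x - y)\<bar> \<le> \<bar>D (\<i> * \<tau>)\<bar> / 2 * dist x y"
    using strict[of "\<bar>D (\<i> * \<tau>)\<bar> / 2"] by auto
  show ?thesis unfolding eventually_nhds_metric
  proof (rule exI[of _ "min d \<epsilon>"], intro conjI allI impI)
    fix z assume zd: "dist z q < min d \<epsilon>" and fz: "f z = 0"
    define w where "w = (z - q) / \<tau>"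
    define s r where "s = Re w" and "r = Im w"
    have \<tau>0: "\<tau> \<noteq> 0" using \<tau> by auto
    have "z = q + w * \<tau>" using \<tau>0 by (simp add: w_def)
    moreover have "w = of_real s + \<i> * of_real r" by (simp add: s_def r_def complex_eq_iff)
    ultimately have z: "z = q + of_real s * \<tau> + of_real r * (\<i> * \<tau>)" by (simp add: algebra_simps)
    have "norm w = dist z q" by (simp add: w_def norm_divide \<tau> dist_norm)
    then have s: "\<bar>s\<bar> \<le> dist z q" using abs_Re_le_cmod[of w] by (simp add: s_def)
    \<comment> \<open>The foot of the perpendicular from \<open>z\<close> to the line: a second zero
      of \<open>f\<close>, differing from \<open>z\<close> only in the normal direction.\<close>
    define y where "y = q + of_real s * \<tau>"
    have fy: "f y = 0" unfolding y_def using s zd by (intro z0) auto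
    have yd: "dist y q \<le> d" using s zd \<tau> by (simp add: y_def dist_norm norm_mult)
    have zy: "z - y = of_real r * (\<i> * \<tau>)" using z by (simp add: y_def)
    have "D (z - y) = r * D (\<i> * \<tau>)" unfolding zy by (simp add: D_def algebra_simps)
    moreover have "dist z y = \<bar>r\<bar>" unfolding dist_norm zy by (simp add: norm_mult \<tau>)
    ultimately have "\<bar>r\<bar> * \<bar>D (\<i> * \<tau>)\<bar> \<le> \<bar>D (\<i> * \<tau>)\<bar> / 2 * \<bar>r\<bar>"
      using H[of z y] zd yd fz fy by (simp add: abs_mult)
    then have "\<bar>r\<bar> * \<bar>D (\<i> * \<tau>)\<bar> \<le> 0" by simp
    then have "r = 0" using nz by (auto simp: mult_le_0_iff)
    then show "\<exists>s. z = q + of_real s * \<tau>" using z by auto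
  qed (use d \<epsilon> in auto)
qed

text \<open>Connectedness argument: the points near which the curve stays on the line
  \<open>L\<close> form an open set, and analyticity makes its trace on the curve relatively
  closed.\<close>

lemma analytic_curve_locally_line_imp_collinear:
  assumes cu: "nonsingular_analytic_curve f W \<Gamma>" and con: "connected \<Gamma>"
    and p: "p \<in> \<Gamma>" and \<tau>: "norm \<tau> = 1"
    and loc: "\<forall>\<^sub>F z in nhds p. z \<in> \<Gamma> \<longrightarrow> (\<exists>s. z = p + of_real s * \<tau>)"
  shows "collinear \<Gamma>"
proof -
  define L where "L = range (\<lambda>s::real. p + of_real s * \<tau>)"
  define A where "A = {q. \<forall>\<^sub>F z in nhds q. z \<in> \<Gamma> \<longrightarrow> z \<in> L}"
  have \<tau>0: "\<tau> \<noteq> 0" using \<tau> by auto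
  have L: "L = (\<lambda>z. Im ((z - p) / \<tau>)) -` {0}"
  proof -
    have "z \<in> L" if "Im ((z - p) / \<tau>) = 0" for z
    proof -
      have "(z - p) / \<tau> = of_real (Re ((z - p) / \<tau>))" using that by (simp add: complex_eq_iff)
      then have "z = p + of_real (Re ((z - p) / \<tau>)) * \<tau>" using \<tau>0 by (simp add: field_simps)
      then show ?thesis by (auto simp: L_def)
    qed
    then show ?thesis using \<tau>0 by (auto simp: L_def)
  qed
  have clL: "closed L" unfolding L
    by (intro closed_vimage continuous_intros) (use \<tau>0 in auto)
  have opA: "open A"
  proof (subst open_subopen, intro ballI)
    fix q assume "q \<in> A"
    then obtain T where "open T" "q \<in> T" "\<forall>z\<in>T. z \<in> \<Gamma> \<longrightarrow> z \<in> L"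
      unfolding A_def eventually_nhds by auto
    then show "\<exists>T. open T \<and> q \<in> T \<and> T \<subseteq> A"
      unfolding A_def eventually_nhds by blast
  qed
  have AL: "q \<in> L" if "q \<in> A" "q \<in> \<Gamma>" for q
    using that eventually_nhds_x_imp_x unfolding A_def by blast
  \<comment> \<open>At a limit point of \<open>A\<close> the zeros of \<open>f\<close> on the line accumulate, so \<open>f\<close> vanishes on the line nearby.\<close>
  have cl: "q \<in> A" if q: "q \<in> \<Gamma>" and lim: "q \<in> closure (\<Gamma> \<inter> A)" for q
  proof (rule ccontr)
    assume qA: "q \<notin> A"
    have qL: "q \<in> L"
      using lim AL closure_minimal[OF _ clL, of "\<Gamma> \<inter> A"] by blast
    then obtain s0 where s0: "q = p + of_real s0 * \<tau>" by (auto simp: L_def)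
    have qW: "q \<in> W" and fq: "f q = 0" and g0: "(pdx f q, pdy f q) \<noteq> (0, 0)"
      and \<Gamma>: "\<Gamma> = {z \<in> W. f z = 0}"
      using q cu by (auto simp: nonsingular_analytic_curve_def)
    then obtain C where C: "has_expansion_at f C q"
      using cu by (auto simp: nonsingular_analytic_curve_def real_analytic_on_def)
    have "\<exists>\<^sub>F s in at 0. f (q + of_real s * \<tau>) = 0"
      unfolding frequently_at
    proof (intro allI impI)
      fix d :: real assume "d > 0"
      then obtain x where x: "x \<in> \<Gamma> \<inter> A" "dist x q < d"
        using lim closure_approachable by blast
      then obtain s1 where s1: "x = p + of_real s1 * \<tau>" using AL by (auto simp: L_def)
      define s where "s = s1 - s0"
      have xs: "x = q + of_real s * \<tau>" by (simp add: s0 s1 s_def algebra_simps)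
      have "x \<noteq> q" using x qA by auto
      then show "\<exists>s\<in>UNIV. s \<noteq> 0 \<and> dist s 0 < d \<and> f (q + of_real s * \<tau>) = 0"
        using x xs \<tau> \<Gamma> by (intro bexI[of _ s]) (auto simp: dist_norm norm_mult)
    qed
    from analytic_zero_along_line[OF C fq this]
    have "\<forall>\<^sub>F z in nhds q. f z = 0 \<longrightarrow> (\<exists>s. z = q + of_real s * \<tau>)"
      using g0 expansion_pdx_pdy[OF C] \<tau> by (intro nonsingular_on_line[OF C]) auto
    then have "q \<in> A" unfolding A_def mem_Collect_eq
    proof eventually_elim
      case (elim z)
      show ?case
      proof
        assume "z \<in> \<Gamma>"
        then obtain s where "z = q + of_real s * \<tau>" using elim \<Gamma> by auto
        then have "z = p + of_real (s0 + s) * \<tau>" by (simp add: s0 algebra_simps)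
        then show "z \<in> L" unfolding L_def by blast
      qed
    qed
    with qA show False ..
  qed
  have "p \<in> A" using loc by (simp add: A_def L_def image_iff)
  have "\<Gamma> \<subseteq> A"
  proof -
    \<comment> \<open>\<open>A\<close> and the complement of the closure of
      \<open>\<Gamma> \<inter> A\<close> are open and would separate the curve; the first one
      contains \<open>p\<close>, so the second misses the curve.\<close>
    have disj: "A \<inter> (- closure (\<Gamma> \<inter> A)) \<inter> \<Gamma> = {}" using closure_subset[of "\<Gamma> \<inter> A"] by blast
    have cov: "\<Gamma> \<subseteq> A \<union> (- closure (\<Gamma> \<inter> A))" using cl by blast
    have "open (- closure (\<Gamma> \<inter> A))" by (rule open_Compl[OF closed_closure])
    from connectedD[OF con opA this disj cov] have "A \<inter> \<Gamma> = {} \<or> - closure (\<Gamma> \<inter> A) \<inter> \<Gamma> = {}" .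
    then show ?thesis using p \<open>p \<in> A\<close> cl by blast
  qed
  then have "\<Gamma> \<subseteq> L" using AL by blast
  show ?thesis unfolding collinear_def
  proof (intro exI[of _ \<tau>] ballI)
    fix x y assume "x \<in> \<Gamma>" "y \<in> \<Gamma>"
    then obtain s t where xy: "x = p + of_real s * \<tau>" "y = p + of_real t * \<tau>"
      using \<open>\<Gamma> \<subseteq> L\<close> unfolding L_def by (meson rangeE subsetD)
    have "x - y = (s - t) *\<^sub>R \<tau>" by (simp only: xy scaleR_conv_of_real of_real_diff ring_distribs add_diff_add diff_self add_0_left)
    then show "\<exists>c. x - y = c *\<^sub>R \<tau>" ..
  qed
qed

section \<open>Wirtinger derivatives\<close>

text \<open>\<open>A\<close> and \<open>B\<close> are the derivatives with respect to \<open>z\<close> and \<open>cnj z\<close>; \<open>h\<close> is only real differentiable.\<close>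

definition has_wirtinger :: "(complex \<Rightarrow> complex) \<Rightarrow> complex \<Rightarrow> complex \<Rightarrow> complex \<Rightarrow> bool" where
  "has_wirtinger h A B z \<longleftrightarrow> (h has_derivative (\<lambda>d. A * d + B * cnj d)) (at z)"

lemma has_wirtinger_imp_continuous_on:
  assumes "\<And>z. z \<in> U \<Longrightarrow> has_wirtinger h (A z) (B z) z"
  shows "continuous_on U h"
  by (intro continuous_at_imp_continuous_on ballI has_derivative_continuous[OF assms[unfolded has_wirtinger_def]])

lemma has_wirtinger_mult:
  assumes "has_wirtinger h A B z" "has_wirtinger k A' B' z"
  shows "has_wirtinger (\<lambda>z. h z * k z) (h z * A' + A * k z) (h z * B' + B * k z) z"
  using has_derivative_mult[OF assms[unfolded has_wirtinger_def]]
  by (simp add: has_wirtinger_def algebra_simps)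

lemma has_wirtinger_add:
  assumes "has_wirtinger h A B z" "has_wirtinger k A' B' z"
  shows "has_wirtinger (\<lambda>z. h z + k z) (A + A') (B + B') z"
  using has_derivative_add[OF assms[unfolded has_wirtinger_def]]
  by (simp add: has_wirtinger_def algebra_simps)

lemma has_wirtinger_diff:
  assumes "has_wirtinger h A B z" "has_wirtinger k A' B' z"
  shows "has_wirtinger (\<lambda>z. h z - k z) (A - A') (B - B') z"
  using has_derivative_diff[OF assms[unfolded has_wirtinger_def]]
  by (simp add: has_wirtinger_def algebra_simps)

lemma has_wirtinger_cmult:
  assumes "has_wirtinger h A B z"
  shows "has_wirtinger (\<lambda>z. c * h z) (c * A) (c * B) z"
  using has_derivative_mult_right[OF assms[unfolded has_wirtinger_def], of c]
  by (simp add: has_wirtinger_def algebra_simps)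

lemma has_wirtinger_holomorphic:
  "(h has_field_derivative A) (at z) \<Longrightarrow> has_wirtinger h A 0 z"
  by (simp add: has_wirtinger_def has_field_derivative_def)

lemma has_wirtinger_antiholomorphic:
  assumes "(h has_field_derivative A) (at z)"
  shows "has_wirtinger (\<lambda>z. cnj (h z)) 0 (cnj A) z"
  using bounded_linear.has_derivative[OF bounded_linear_cnj assms[unfolded has_field_derivative_def]]
  by (simp add: has_wirtinger_def)

lemma has_wirtinger_cong_open:
  assumes "has_wirtinger h A B z" "open U" "z \<in> U" "\<And>w. w \<in> U \<Longrightarrow> k w = h w"
  shows "has_wirtinger k A B z"
  unfolding has_wirtinger_def
  by (rule has_derivative_transform_within_open[OF assms(1)[unfolded has_wirtinger_def] assms(2,3)])
     (simp add: assms(4))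

lemma has_wirtinger_pdx_pdy:
  assumes "has_wirtinger h A B z"
  shows "((\<lambda>t::real. h (z + of_real t)) has_vector_derivative A + B) (at 0)"
    and "((\<lambda>t::real. h (z + \<i> * of_real t)) has_vector_derivative \<i> * (A - B)) (at 0)"
    and "pdx h z = A + B" "pdy h z = \<i> * (A - B)"
proof -
  have *: "((\<lambda>t::real. h (z + w * of_real t)) has_vector_derivative A * w + B * cnj w) (at 0)" for w
  proof -
    have 1: "((\<lambda>t::real. z + w * of_real t) has_derivative (\<lambda>t. w * of_real t)) (at 0)"
      by (auto intro!: derivative_eq_intros)
    have "(h has_derivative (\<lambda>d. A * d + B * cnj d)) (at (z + w * of_real 0))"
      using assms by (simp add: has_wirtinger_def)
    from has_derivative_compose[OF 1 this] show ?thesis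
      by (simp add: has_vector_derivative_def scaleR_conv_of_real algebra_simps)
  qed
  show 1: "((\<lambda>t::real. h (z + of_real t)) has_vector_derivative A + B) (at 0)"
    using *[of 1] by simp
  show 2: "((\<lambda>t::real. h (z + \<i> * of_real t)) has_vector_derivative \<i> * (A - B)) (at 0)"
    using *[of \<i>] by (simp add: algebra_simps)
  show "pdx h z = A + B" "pdy h z = \<i> * (A - B)"
    using vector_derivative_at[OF 1] vector_derivative_at[OF 2] by (simp_all add: pdx_def pdy_def)
qed

lemma has_wirtinger_imp_C1_on:
  assumes w: "\<And>z. z \<in> U \<Longrightarrow> has_wirtinger h (A z) (B z) z"
    and "continuous_on U A" "continuous_on U B"
  shows "C1_on h U"
proof -
  have "continuous_on U (pdx h) \<longleftrightarrow> continuous_on U (\<lambda>z. A z + B z)"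
    by (intro continuous_on_cong refl has_wirtinger_pdx_pdy(3) w)
  moreover have "continuous_on U (pdy h) \<longleftrightarrow> continuous_on U (\<lambda>z. \<i> * (A z - B z))"
    by (intro continuous_on_cong refl has_wirtinger_pdx_pdy(4) w)
  moreover have "continuous_on U (\<lambda>z. A z + B z)" "continuous_on U (\<lambda>z. \<i> * (A z - B z))"
    using assms by (auto intro!: continuous_intros)
  ultimately show ?thesis
    unfolding C1_on_def
    using has_wirtinger_imp_continuous_on[OF w] has_wirtinger_pdx_pdy(1,2)[OF w]
    by (auto intro: differentiableI_vector)
qed

text \<open>With \<open>pdx u = p + q\<close> and \<open>pdy u = \<i> * (p - q)\<close> the pure
  second derivatives cancel in the Laplacian. The mixed derivatives \<open>p2\<close> and
  \<open>q1\<close> stay separate, so symmetry of second derivatives is not invoked.\<close>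

lemma has_wirtinger_imp_pde_solution:
  assumes U: "open U"
    and u: "\<And>z. z \<in> U \<Longrightarrow> has_wirtinger u (p z) (q z) z"
    and p: "\<And>z. z \<in> U \<Longrightarrow> has_wirtinger p (p1 z) (p2 z) z"
    and q: "\<And>z. z \<in> U \<Longrightarrow> has_wirtinger q (q1 z) (q2 z) z"
    and cont: "continuous_on U p1" "continuous_on U p2" "continuous_on U q1" "continuous_on U q2"
    and eq: "\<And>z. z \<in> U \<Longrightarrow> 2 * (p2 z + q1 z) + (of_real a + \<i> * of_real b) * p z
               + (of_real a - \<i> * of_real b) * q z + of_real c * u z = 0"
  shows "pde_solution a b c U u"
proof -
  have x: "has_wirtinger (pdx u) (p1 z + q1 z) (p2 z + q2 z) z" if "z \<in> U" for z
    by (rule has_wirtinger_cong_open[OF has_wirtinger_add[OF p[OF that] q[OF that]] U that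
          has_wirtinger_pdx_pdy(3)[OF u]])
  have y: "has_wirtinger (pdy u) (\<i> * (p1 z - q1 z)) (\<i> * (p2 z - q2 z)) z" if "z \<in> U" for z
    by (rule has_wirtinger_cong_open[OF has_wirtinger_cmult[OF has_wirtinger_diff[OF p[OF that] q[OF that]]] U that
          has_wirtinger_pdx_pdy(4)[OF u]])
  have "C2_on u U"
    unfolding C2_on_def
  proof (intro conjI)
    show "C1_on u U"
      using u p q by (intro has_wirtinger_imp_C1_on[where A = p and B = q] has_wirtinger_imp_continuous_on) auto
    show "C1_on (pdx u) U"
      by (rule has_wirtinger_imp_C1_on[OF x]) (auto intro!: continuous_intros cont)
    show "C1_on (pdy u) U"
      by (rule has_wirtinger_imp_C1_on[OF y]) (auto intro!: continuous_intros cont)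
  qed
  moreover have "laplacian u z + of_real a * pdx u z + of_real b * pdy u z + of_real c * u z = 0"
    if z: "z \<in> U" for z
  proof -
    have "laplacian u z = 2 * (p2 z + q1 z)"
      unfolding laplacian_def has_wirtinger_pdx_pdy(3)[OF x[OF z]] has_wirtinger_pdx_pdy(4)[OF y[OF z]]
      by (simp add: algebra_simps)
    then show ?thesis
      unfolding has_wirtinger_pdx_pdy(3,4)[OF u[OF z]] using eq[OF z] by (simp add: algebra_simps)
  qed
  ultimately show ?thesis by (simp add: pde_solution_def)
qed

section \<open>Solutions from path integrals\<close>

text \<open>A path integral over an unspecified path in \<open>U\<close>, defined by a primitive. It is meaningful
  only if \<open>f\<close> has a primitive on \<open>U\<close>; additivity in the endpoints holds regardless.\<close>

definition lint :: "complex set \<Rightarrow> (complex \<Rightarrow> complex) \<Rightarrow> complex \<Rightarrow> complex \<Rightarrow> complex" where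
  "lint U f a b = (let F = (SOME F. \<forall>z\<in>U. (F has_field_derivative f z) (at z)) in F b - F a)"

lemma lint_combine: "lint U f a b + lint U f b c = lint U f a c"
  by (simp add: lint_def Let_def)

lemma lint_self [simp]: "lint U f a a = 0"
  by (simp add: lint_def)

text \<open>Simple connectedness supplies a primitive, hence the choice in \<open>lint\<close> is a
  genuine one and the value is path independent.\<close>

lemma lint_eq_contour_integral:
  assumes "open U" "simply_connected U" "f holomorphic_on U"
    and "valid_path g" "path_image g \<subseteq> U"
  shows "(f has_contour_integral lint U f (pathstart g) (pathfinish g)) g"
proof -
  have "\<forall>f. f holomorphic_on U \<longrightarrow> (\<exists>F. \<forall>z. z \<in> U \<longrightarrow> (F has_field_derivative f z) (at z))"
    using simply_connected_eq_global_primitive[OF assms(1)] assms(2) by simp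
  then have "\<exists>F. \<forall>z\<in>U. (F has_field_derivative f z) (at z)"
    using assms(3) by (simp add: Ball_def)
  then have "\<forall>z\<in>U. ((SOME F. \<forall>z\<in>U. (F has_field_derivative f z) (at z)) has_field_derivative f z) (at z)"
    by (rule someI_ex)
  then show ?thesis
    unfolding lint_def Let_def using assms(4,5)
    by (intro contour_integral_primitive) (auto intro: has_field_derivative_at_within)
qed

section \<open>Differentiation of integrals in a parameter and in an end point\<close>

text \<open>Leibniz rule on the parameter interval. A polynomial path has a continuous velocity
  \<open>g'\<close>, which makes the differentiated integrand jointly continuous.\<close>

lemma has_wirtinger_contour_integral:
  assumes g: "polynomial_function g" "path_image g \<subseteq> U"
    and der: "\<And>z t. t \<in> U \<Longrightarrow> has_wirtinger (\<lambda>z. k z t) (kz z t) (kb z t) z"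
    and ck: "\<And>z. continuous_on U (k z)"
    and cz: "continuous_on (UNIV \<times> U) (\<lambda>(z, t). kz z t)"
    and cb: "continuous_on (UNIV \<times> U) (\<lambda>(z, t). kb z t)"
  shows "has_wirtinger (\<lambda>z. contour_integral g (k z)) (contour_integral g (kz z0)) (contour_integral g (kb z0)) z0"
proof -
  obtain g' where g': "polynomial_function g'" "\<And>x. (g has_vector_derivative g' x) (at x)"
    using has_vector_derivative_polynomial_function[OF g(1)] by blast
  have ci: "contour_integral g f = integral (cbox 0 1) (\<lambda>x. f (g x) * g' x)" for f
    by (simp add: contour_integral_integral vector_derivative_at[OF g'(2)])
  have gU: "g x \<in> U" if "x \<in> cbox 0 1" for x
    using g(2) that by (auto simp: path_image_def)
  have cg: "continuous_on S g" "continuous_on S g'" for S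
    using g(1) g'(1) by (auto intro: continuous_on_polymonial_function)
  have m: "continuous_on (UNIV \<times> cbox 0 1) (\<lambda>x::complex \<times> real. (fst x, g (snd x)))"
    by (intro continuous_on_Pair continuous_on_fst continuous_on_snd continuous_on_id
        continuous_on_compose2[OF cg(1)[of UNIV]]) auto
  have mU: "(\<lambda>x::complex \<times> real. (fst x, g (snd x))) ` (UNIV \<times> cbox 0 1) \<subseteq> UNIV \<times> U"
    using gU by auto
  have m': "continuous_on (UNIV \<times> cbox 0 1) (\<lambda>x::complex \<times> real. g' (snd x))"
    by (intro continuous_on_snd continuous_on_id continuous_on_compose2[OF cg(2)[of UNIV]]) auto
  have c1: "continuous_on (UNIV \<times> cbox 0 1) (\<lambda>x. kz (fst x) (g (snd x)) * g' (snd x))"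
    using continuous_on_mult[OF continuous_on_compose2[OF cz m mU] m'] by simp
  have c2: "continuous_on (UNIV \<times> cbox 0 1) (\<lambda>x. kb (fst x) (g (snd x)) * g' (snd x))"
    using continuous_on_mult[OF continuous_on_compose2[OF cb m mU] m'] by simp
  define cj where "cj = Blinfun cnj"
  have cj: "blinfun_apply cj = cnj" unfolding cj_def by (rule bounded_linear_Blinfun_apply[OF bounded_linear_cnj])
  \<comment> \<open>The real-linear differential as a bounded operator, the form in which
    \<open>leibniz_rule\<close> takes the derivative; conjugation enters as the operator
    \<open>cj\<close>.\<close>
  define fx where "fx = (\<lambda>z x. blinfun_mult_right (kz z (g x) * g' x) + (blinfun_mult_right (kb z (g x) * g' x) o\<^sub>L cj))"
  have fx: "blinfun_apply (fx z x) = (\<lambda>d. (kz z (g x) * g' x) * d + (kb z (g x) * g' x) * cnj d)" for z x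
    by (simp add: fx_def fun_eq_iff blinfun.add_left cj)
  have cfx: "continuous_on (UNIV \<times> cbox 0 1) (\<lambda>(z, x). fx z x)"
    unfolding fx_def case_prod_unfold by (intro continuous_intros c1 c2)
  have L: "((\<lambda>z. integral (cbox 0 1) (\<lambda>x. k z (g x) * g' x)) has_derivative integral (cbox 0 1) (fx z0)) (at z0 within UNIV)"
  proof (rule leibniz_rule[OF _ _ cfx])
    fix z :: complex and x :: real assume x: "x \<in> cbox 0 1"
    have "((\<lambda>z. k z (g x)) has_derivative (\<lambda>d. kz z (g x) * d + kb z (g x) * cnj d)) (at z)"
      using der[OF gU[OF x]] by (simp add: has_wirtinger_def)
    from has_derivative_mult_left[OF this, of "g' x"]
    show "((\<lambda>z. k z (g x) * g' x) has_derivative blinfun_apply (fx z x)) (at z within UNIV)"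
      by (simp add: fx algebra_simps)
  next
    fix z
    have "g ` cbox 0 1 \<subseteq> U" using gU by blast
    from continuous_on_mult[OF continuous_on_compose2[OF ck cg(1) this] cg(2)]
    show "(\<lambda>x. k z (g x) * g' x) integrable_on cbox 0 1"
      by (rule integrable_continuous)
  qed auto
  have Pz0: "continuous_on (cbox 0 1) (\<lambda>x::real. (z0, x))" "(\<lambda>x. (z0, x)) ` cbox 0 1 \<subseteq> UNIV \<times> cbox 0 1"
    by (auto intro!: continuous_intros)
  have ifx: "(fx z0) integrable_on cbox 0 1"
    using integrable_continuous[OF continuous_on_compose2[OF cfx Pz0]] by simp
  have "blinfun_apply (integral (cbox 0 1) (fx z0)) d
      = contour_integral g (kz z0) * d + contour_integral g (kb z0) * cnj d" for d
  proof -
    have cz0: "continuous_on (cbox 0 1) (\<lambda>x. kz z0 (g x) * g' x)"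
      using continuous_on_compose2[OF c1 Pz0] by simp
    have cb0: "continuous_on (cbox 0 1) (\<lambda>x. kb z0 (g x) * g' x)"
      using continuous_on_compose2[OF c2 Pz0] by simp
    have "blinfun_apply (integral (cbox 0 1) (fx z0)) d = integral (cbox 0 1) (\<lambda>x. blinfun_apply (fx z0 x) d)"
      using integral_linear[OF ifx blinfun.bounded_linear_left[of d]] by (simp add: o_def)
    also have "\<dots> = integral (cbox 0 1) (\<lambda>x. kz z0 (g x) * g' x * d) + integral (cbox 0 1) (\<lambda>x. kb z0 (g x) * g' x * cnj d)"
      unfolding fx by (intro integral_add integrable_continuous continuous_intros cz0 cb0)
    finally show ?thesis by (simp add: ci)
  qed
  then have "blinfun_apply (integral (cbox 0 1) (fx z0)) = (\<lambda>d. contour_integral g (kz z0) * d + contour_integral g (kb z0) * cnj d)"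
    by blast
  with L show ?thesis by (simp add: has_wirtinger_def ci)
qed

lemma has_wirtinger_lint_endpoint:
  assumes U: "open U" "simply_connected U" and hol: "\<And>z. k z holomorphic_on U"
    and cont: "continuous_on (UNIV \<times> U) (\<lambda>(z, t). k z t)"
    and a: "\<rho> z0 \<in> U" and \<rho>: "has_wirtinger \<rho> A B z0"
  shows "has_wirtinger (\<lambda>z. lint U (k z) (\<rho> z0) (\<rho> z)) (k z0 (\<rho> z0) * A) (k z0 (\<rho> z0) * B) z0"
proof -
  \<comment> \<open>The end point contributes to first order only through the value of \<open>k\<close> at \<open>(z0, a)\<close>, because
    \<open>k\<close> is jointly continuous and the path from \<open>a\<close> to \<open>\<rho> z\<close> is short.\<close>
  define a where "a = \<rho> z0"
  define D where "D = (\<lambda>d. A * d + B * cnj d)"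
  define E where "E = (\<lambda>z. lint U (k z) a (\<rho> z) - k z0 a * (\<rho> z - a))"
  have E0: "E z0 = 0" by (simp add: E_def a_def)
  have D: "(\<rho> has_derivative D) (at z0)" using \<rho> by (simp add: has_wirtinger_def D_def)
  obtain K where K: "K > 0" "\<And>d. norm (D d) \<le> norm d * K"
    using bounded_linear.pos_bounded[OF has_derivative_bounded_linear[OF D]] by blast
  obtain d1 where d1: "d1 > 0" and "\<And>y. norm (y - z0) < d1 \<Longrightarrow> norm (\<rho> y - \<rho> z0 - D (y - z0)) \<le> 1 * norm (y - z0)"
    using D unfolding has_derivative_at_alt by (meson zero_less_one)
  then have lip: "norm (\<rho> y - a) \<le> (K + 1) * norm (y - z0)" if "norm (y - z0) < d1" for y
  proof -
    have "norm (\<rho> y - a) \<le> norm (\<rho> y - \<rho> z0 - D (y - z0)) + norm (D (y - z0))"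
      unfolding a_def by (metis diff_add_cancel norm_triangle_ineq)
    also have "\<dots> \<le> norm (y - z0) + norm (y - z0) * K"
      using that d1 \<open>\<And>y. norm (y - z0) < d1 \<Longrightarrow> norm (\<rho> y - \<rho> z0 - D (y - z0)) \<le> 1 * norm (y - z0)\<close>[OF that]
      by (intro add_mono K(2)) auto
    finally show ?thesis by (simp add: algebra_simps)
  qed
  have "(E has_derivative (\<lambda>d. 0)) (at z0)"
    unfolding has_derivative_at_alt
  proof (intro conjI allI impI)
    fix e :: real assume "e > 0"
    define \<epsilon> where "\<epsilon> = e / (K + 1)"
    have \<epsilon>: "\<epsilon> > 0" "\<epsilon> * (K + 1) = e" using K(1) \<open>e > 0\<close> by (auto simp: \<epsilon>_def)
    have "isCont (\<lambda>(z, t). k z t) (z0, a)"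
      using cont a U(1) by (subst (asm) continuous_on_eq_continuous_at) (auto simp: a_def intro: open_Times)
    then obtain \<delta> where \<delta>: "\<delta> > 0" and kc: "\<And>z t. dist (z, t) (z0, a) < \<delta> \<Longrightarrow> dist (k z t) (k z0 a) < \<epsilon>"
      unfolding continuous_at_eps_delta using \<epsilon>(1) by force
    obtain r where r: "r > 0" "ball a r \<subseteq> U"
      using U(1) a openE unfolding a_def by blast
    define m where "m = min r (\<delta> / 2)"
    have m: "m > 0" "m \<le> r" "m \<le> \<delta> / 2" using r \<delta> by (auto simp: m_def)
    \<comment> \<open>The three bounds give the Lipschitz estimate for \<open>\<rho>\<close>, a
      parameter within \<open>\<delta> / 2\<close> of \<open>z0\<close>, and a segment within
      \<open>m\<close> of \<open>a\<close>. As \<open>m\<close> is at most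
      \<open>\<delta> / 2\<close>, the pair of parameter and segment point is within
      \<open>\<delta>\<close>.\<close>
    define d where "d = min d1 (min (\<delta> / 2) (m / (K + 1)))"
    have d: "d > 0" "d \<le> d1" "d \<le> \<delta> / 2"
      using d1 \<delta> m K(1) unfolding d_def by (simp, simp, linarith)
    have dK: "(K + 1) * d \<le> m"
    proof -
      have "d \<le> m / (K + 1)" by (simp add: d_def)
      then show ?thesis using K(1) by (simp add: pos_le_divide_eq mult.commute)
    qed
    show "\<exists>d>0. \<forall>y. norm (y - z0) < d \<longrightarrow> norm (E y - E z0 - 0) \<le> e * norm (y - z0)"
    proof (rule exI[of _ d], intro conjI allI impI)
      fix y assume y: "norm (y - z0) < d"
      have lip': "norm (\<rho> y - a) \<le> (K + 1) * norm (y - z0)" using lip y d by simp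
      also have "\<dots> < (K + 1) * d" using y K(1) by simp
      finally have \<rho>m: "norm (\<rho> y - a) < m" using dK by linarith
      have seg: "norm (t - a) < m" if "t \<in> closed_segment a (\<rho> y)" for t
        using segment_bound1[OF that] \<rho>m by simp
      have "closed_segment a (\<rho> y) \<subseteq> U"
        using seg m r by (force simp: dist_norm norm_minus_commute)
      then have "(k y has_contour_integral lint U (k y) a (\<rho> y)) (linepath a (\<rho> y))"
        using lint_eq_contour_integral[OF U hol, of "linepath a (\<rho> y)" y] by simp
      moreover have "((\<lambda>t. k z0 a) has_contour_integral k z0 a * (\<rho> y - a)) (linepath a (\<rho> y))"
        by (rule has_contour_integral_const_linepath)
      ultimately have "((\<lambda>t. k y t - k z0 a) has_contour_integral E y) (linepath a (\<rho> y))"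
        unfolding E_def by (rule has_contour_integral_diff)
      then have "norm (E y) \<le> \<epsilon> * norm (\<rho> y - a)"
      proof (rule has_contour_integral_bound_linepath)
        fix t assume t: "t \<in> closed_segment a (\<rho> y)"
        have "dist (y, t) (z0, a) \<le> dist y z0 + dist t a"
          by (simp add: dist_Pair_Pair sqrt_sum_squares_le_sum)
        also have "\<dots> < \<delta>" using seg[OF t] y d m by (simp add: dist_norm)
        finally show "norm (k y t - k z0 a) \<le> \<epsilon>" using kc by (simp add: dist_norm less_imp_le)
      qed (use \<epsilon> in simp)
      also have "\<dots> \<le> \<epsilon> * ((K + 1) * norm (y - z0))"
        using lip' \<epsilon> by (intro mult_left_mono) auto
      also have "\<dots> = e * norm (y - z0)" using \<epsilon>(2) by (simp only: mult.assoc[symmetric])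
      finally show "norm (E y - E z0 - 0) \<le> e * norm (y - z0)" by (simp add: E0)
    qed (rule d(1))
  qed (rule bounded_linear_zero)
  then have 1: "has_wirtinger E 0 0 z0" by (simp add: has_wirtinger_def)
  have "has_wirtinger (\<lambda>z. \<rho> z - a) A B z0"
    using has_wirtinger_diff[OF \<rho> has_wirtinger_holomorphic[OF DERIV_const[of a]]] by simp
  from has_wirtinger_add[OF 1 has_wirtinger_cmult[OF this, of "k z0 a"]]
  show ?thesis by (simp add: E_def a_def)
qed

lemma has_wirtinger_compose:
  assumes "(g has_field_derivative g') (at (h z))" "has_wirtinger h A B z"
  shows "has_wirtinger (\<lambda>z. g (h z)) (g' * A) (g' * B) z"
  using has_derivative_compose[OF assms(2)[unfolded has_wirtinger_def] assms(1)[unfolded has_field_derivative_def]]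
  by (simp add: has_wirtinger_def algebra_simps)

section \<open>The reflected integral and its Wirtinger derivatives\<close>

text \<open>The involution \<open>R z = cnj (S z)\<close> is expressed through the holomorphic
  \<open>S\<close>; the curve is represented by the condition \<open>S z = cnj z\<close>.\<close>

locale schwarz_domain =
  fixes U :: "complex set" and S :: "complex \<Rightarrow> complex"
  assumes opn: "open U" and simply_conn: "simply_connected U"
    and S_hol: "S holomorphic_on U"
    and refl_in: "\<And>z. z \<in> U \<Longrightarrow> cnj (S z) \<in> U"
    and S_refl: "\<And>z. z \<in> U \<Longrightarrow> S (cnj (S z)) = cnj z"
begin

text \<open>The point is both parameter of the integrand and end point. Where
  \<open>S z = cnj z\<close> the two end points coincide, so the integral vanishes on the
  curve.\<close>

definition refl_integral :: "(complex \<Rightarrow> complex \<Rightarrow> complex) \<Rightarrow> complex \<Rightarrow> complex" where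
  "refl_integral k z = lint U (k z) (cnj (S z)) z"

text \<open>One path serves all integrands, so it can be held fixed while the integrand is
  differentiated in its parameter.\<close>

lemma lint_obtain_path:
  assumes "a \<in> U" "b \<in> U"
  obtains g where "polynomial_function g" "path_image g \<subseteq> U"
    and "\<And>f. f holomorphic_on U \<Longrightarrow> lint U f a b = contour_integral g f"
proof -
  obtain g where g: "polynomial_function g" "path_image g \<subseteq> U" "pathstart g = a" "pathfinish g = b"
    using connected_open_polynomial_connected[OF opn simply_connected_imp_connected[OF simply_conn] assms]
    by blast
  show ?thesis
  proof (rule that[OF g(1,2)])
    fix f assume "f holomorphic_on U"
    then show "lint U f a b = contour_integral g f"
      using lint_eq_contour_integral[OF opn simply_conn _ valid_path_polynomial_function[OF g(1)] g(2)] g(3,4)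
      by (metis contour_integral_unique)
  qed
qed

text \<open>The dependence on the point is split into that of the integrand, between frozen end
  points, and that of each end point. The upper one is holomorphic in \<open>z\<close> and the lower
  one antiholomorphic, so each adds a boundary term to just one derivative.\<close>

lemma has_wirtinger_refl_integral:
  assumes der: "\<And>z t. t \<in> U \<Longrightarrow> has_wirtinger (\<lambda>z. k z t) (kz z t) (kb z t) z"
    and hol: "\<And>z. k z holomorphic_on U" "\<And>z. kz z holomorphic_on U" "\<And>z. kb z holomorphic_on U"
    and cont: "continuous_on (UNIV \<times> U) (\<lambda>(z, t). k z t)"
      "continuous_on (UNIV \<times> U) (\<lambda>(z, t). kz z t)" "continuous_on (UNIV \<times> U) (\<lambda>(z, t). kb z t)"
    and z: "z \<in> U"
  shows "has_wirtinger (refl_integral k) (refl_integral kz z + k z z)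
           (refl_integral kb z - k z (cnj (S z)) * cnj (deriv S z)) z"
proof -
  obtain g where g: "polynomial_function g" "path_image g \<subseteq> U"
      "\<And>f. f holomorphic_on U \<Longrightarrow> lint U f (cnj (S z)) z = contour_integral g f"
    using lint_obtain_path[OF refl_in[OF z] z] by blast
  have "has_wirtinger (\<lambda>w. contour_integral g (k w)) (contour_integral g (kz z)) (contour_integral g (kb z)) z"
    by (rule has_wirtinger_contour_integral[OF g(1,2) der holomorphic_on_imp_continuous_on[OF hol(1)] cont(2,3)])
  then have 1: "has_wirtinger (\<lambda>w. lint U (k w) (cnj (S z)) z) (refl_integral kz z) (refl_integral kb z) z"
    by (simp add: refl_integral_def g(3) hol)
  have 2: "has_wirtinger (\<lambda>w. lint U (k w) z w) (k z z * 1) (k z z * 0) z"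
    by (rule has_wirtinger_lint_endpoint[where \<rho> = "\<lambda>w. w", OF opn simply_conn hol(1) cont(1) z
          has_wirtinger_holomorphic[OF DERIV_ident]])
  have "(S has_field_derivative deriv S z) (at z)"
    using holomorphic_derivI[OF S_hol opn z] .
  then have 3: "has_wirtinger (\<lambda>w. lint U (k w) (cnj (S z)) (cnj (S w))) (k z (cnj (S z)) * 0)
      (k z (cnj (S z)) * cnj (deriv S z)) z"
    by (intro has_wirtinger_lint_endpoint[where \<rho> = "\<lambda>w. cnj (S w)", OF opn simply_conn hol(1) cont(1) refl_in[OF z]]
        has_wirtinger_antiholomorphic)
  have "refl_integral k w = lint U (k w) (cnj (S z)) z + lint U (k w) z w - lint U (k w) (cnj (S z)) (cnj (S w))" for w
    by (simp add: refl_integral_def lint_def Let_def)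
  then have "refl_integral k = (\<lambda>w. lint U (k w) (cnj (S z)) z + lint U (k w) z w - lint U (k w) (cnj (S z)) (cnj (S w)))"
    by blast
  with has_wirtinger_diff[OF has_wirtinger_add[OF 1 2] 3] show ?thesis by simp
qed

text \<open>The density times the Riemann function is the case \<open>m = n = 0\<close>; the powers
  make the family closed under \<open>\<partial>/\<partial>z\<close> and \<open>\<partial>/\<partial>(cnj z)\<close>.\<close>

definition kern :: "(complex \<Rightarrow> complex) \<Rightarrow> nat \<Rightarrow> nat \<Rightarrow> (complex \<Rightarrow> complex) \<Rightarrow> complex \<Rightarrow> complex \<Rightarrow> complex" where
  "kern \<Phi> m n g z t = \<Phi> t * (z - t) ^ m * (cnj z - S t) ^ n * g ((z - t) * (cnj z - S t))"

lemma kern_holomorphic: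
  assumes "\<Phi> holomorphic_on UNIV" "g holomorphic_on UNIV"
  shows "kern \<Phi> m n g z holomorphic_on U"
proof -
  have "(\<lambda>t. g ((z - t) * (cnj z - S t))) holomorphic_on U"
    by (rule holomorphic_on_compose_gen[OF _ assms(2), unfolded o_def]) (auto intro!: holomorphic_intros S_hol)
  moreover have "\<Phi> holomorphic_on U" using assms(1) holomorphic_on_subset by blast
  ultimately show ?thesis
    unfolding kern_def by (intro holomorphic_intros S_hol)
qed

lemma kern_continuous:
  assumes "\<Phi> holomorphic_on UNIV" "g holomorphic_on UNIV"
  shows "continuous_on (UNIV \<times> U) (\<lambda>(z, t). kern \<Phi> m n g z t)"
proof -
  have c: "continuous_on UNIV \<Phi>" "continuous_on UNIV g" "continuous_on U S"
    using assms S_hol holomorphic_on_imp_continuous_on by auto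
  have s: "continuous_on (UNIV \<times> U) (\<lambda>x::complex \<times> complex. S (snd x))"
    by (rule continuous_on_compose2[OF c(3)]) (auto intro!: continuous_intros)
  have p: "continuous_on (UNIV \<times> U) (\<lambda>x::complex \<times> complex. \<Phi> (snd x))"
    by (rule continuous_on_compose2[OF c(1)]) (auto intro!: continuous_intros)
  have "continuous_on (UNIV \<times> U) (\<lambda>x. g ((fst x - snd x) * (cnj (fst x) - S (snd x))))"
    by (rule continuous_on_compose2[OF c(2)]) (auto intro!: continuous_intros s)
  with p s show ?thesis
    unfolding kern_def case_prod_unfold by (intro continuous_intros)
qed

text \<open>Differentiating the argument of \<open>g\<close> in one variable raises the power of the
  other factor. For \<open>m = 0\<close> or \<open>n = 0\<close> the truncated exponent is harmless,
  its coefficient being zero.\<close>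

lemma kern_has_wirtinger:
  assumes "g holomorphic_on UNIV"
  shows "has_wirtinger (\<lambda>z. kern \<Phi> m n g z t)
    (of_nat m * kern \<Phi> (m - 1) n g z t + kern \<Phi> m (n + 1) (deriv g) z t)
    (of_nat n * kern \<Phi> m (n - 1) g z t + kern \<Phi> (m + 1) n (deriv g) z t) z"
proof -
  have pw: "has_wirtinger (\<lambda>z. h z ^ j) (of_nat j * h z ^ (j - 1) * A) (of_nat j * h z ^ (j - 1) * B) z"
    if "has_wirtinger h A B z" for h :: "complex \<Rightarrow> complex" and A B z and j :: nat
    using has_derivative_power[OF that[unfolded has_wirtinger_def], of j]
    by (simp add: has_wirtinger_def algebra_simps)
  have g': "(g has_field_derivative deriv g w) (at w)" for w
    using holomorphic_derivI[OF assms open_UNIV UNIV_I] .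
  have x: "has_wirtinger (\<lambda>z. z - t) 1 0 z"
    by (intro has_wirtinger_holomorphic derivative_eq_intros) auto
  have "has_wirtinger cnj 0 1 z"
    using has_wirtinger_antiholomorphic[OF DERIV_ident] by simp
  from has_wirtinger_diff[OF this has_wirtinger_holomorphic[OF DERIV_const[of "S t"]]]
  have y: "has_wirtinger (\<lambda>z. cnj z - S t) 0 1 z" by simp
  show ?thesis
    using has_wirtinger_cmult[OF has_wirtinger_mult[OF has_wirtinger_mult[OF pw[OF x, of m] pw[OF y, of n]]
          has_wirtinger_compose[OF g' has_wirtinger_mult[OF x y]]], of "\<Phi> t"]
    by (simp add: kern_def algebra_simps)
qed

lemma has_wirtinger_refl_integral_kern:
  assumes "\<Phi> holomorphic_on UNIV" "g holomorphic_on UNIV" "z \<in> U"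
  shows "has_wirtinger (refl_integral (kern \<Phi> m n g))
    (refl_integral (\<lambda>z t. of_nat m * kern \<Phi> (m - 1) n g z t + kern \<Phi> m (n + 1) (deriv g) z t) z + kern \<Phi> m n g z z)
    (refl_integral (\<lambda>z t. of_nat n * kern \<Phi> m (n - 1) g z t + kern \<Phi> (m + 1) n (deriv g) z t) z
       - kern \<Phi> m n g z (cnj (S z)) * cnj (deriv S z)) z"
proof (rule has_wirtinger_refl_integral[OF kern_has_wirtinger[OF assms(2)]])
  have g': "deriv g holomorphic_on UNIV" using assms(2) by (intro holomorphic_deriv) auto
  note hol = kern_holomorphic[OF assms(1,2)] kern_holomorphic[OF assms(1) g']
  note con = kern_continuous[OF assms(1,2), unfolded case_prod_unfold] kern_continuous[OF assms(1) g', unfolded case_prod_unfold]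
  fix z
  show "kern \<Phi> m n g z holomorphic_on U" by (rule hol)
  show "(\<lambda>t. of_nat m * kern \<Phi> (m - 1) n g z t + kern \<Phi> m (n + 1) (deriv g) z t) holomorphic_on U"
    "(\<lambda>t. of_nat n * kern \<Phi> m (n - 1) g z t + kern \<Phi> (m + 1) n (deriv g) z t) holomorphic_on U"
    by (intro holomorphic_intros hol)+
  show "continuous_on (UNIV \<times> U) (\<lambda>(z, t). of_nat m * kern \<Phi> (m - 1) n g z t + kern \<Phi> m (n + 1) (deriv g) z t)"
    "continuous_on (UNIV \<times> U) (\<lambda>(z, t). of_nat n * kern \<Phi> m (n - 1) g z t + kern \<Phi> (m + 1) n (deriv g) z t)"
    unfolding case_prod_unfold by (intro continuous_intros con)+
qed (use assms in \<open>auto intro: kern_continuous\<close>)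

end

section \<open>The Riemann function as a power series\<close>

text \<open>This is \<open>J\<^sub>0 (2 sqrt (- \<mu> w))\<close>.\<close>

definition bessel :: "complex \<Rightarrow> complex \<Rightarrow> complex" where
  "bessel \<mu> w = (\<Sum>n. \<mu> ^ n / (fact n)\<^sup>2 * w ^ n)"

lemma bessel_summable: "summable (\<lambda>n. \<mu> ^ n / (fact n)\<^sup>2 * (w::complex) ^ n)"
proof (rule summable_comparison_test)
  show "summable (\<lambda>n. norm (\<mu> * w) ^ n /\<^sub>R fact n)"
    by (rule summable_exp_generic)
  have "norm (\<mu> ^ n / (fact n)\<^sup>2 * w ^ n) \<le> norm (\<mu> * w) ^ n /\<^sub>R fact n" for n
  proof -
    have "norm (\<mu> ^ n / (fact n)\<^sup>2 * w ^ n) = norm (\<mu> * w) ^ n / (fact n)\<^sup>2"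
      by (simp add: norm_mult norm_divide norm_power power_mult_distrib)
    also have "\<dots> \<le> norm (\<mu> * w) ^ n / fact n"
      by (intro divide_left_mono) (auto simp: power2_eq_square fact_ge_1)
    finally show ?thesis by (simp add: divide_inverse mult.commute)
  qed
  then show "\<exists>N. \<forall>n\<ge>N. norm (\<mu> ^ n / (fact n)\<^sup>2 * w ^ n) \<le> norm (\<mu> * w) ^ n /\<^sub>R fact n"
    by blast
qed

text \<open>The differential equation says that \<open>G (x * y)\<close> satisfies the mixed
  equation in \<open>x\<close> and \<open>y\<close>, since its mixed derivative is
  \<open>G' + x * y * G''\<close>. On coefficients it is the recursion
  \<open>(n + 1)\<^sup>2 * c (n + 1) = \<mu> * c n\<close>.\<close>

lemma bessel_derivs:
  shows bessel_holomorphic: "bessel \<mu> holomorphic_on UNIV"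
    and bessel_0: "bessel \<mu> 0 = 1"
    and deriv_bessel_0: "deriv (bessel \<mu>) 0 = \<mu>"
    and bessel_ode: "deriv (bessel \<mu>) w + w * deriv (deriv (bessel \<mu>)) w = \<mu> * bessel \<mu> w"
proof -
  define c :: "nat \<Rightarrow> complex" where "c = (\<lambda>n. \<mu> ^ n / (fact n)\<^sup>2)"
  have s0: "summable (\<lambda>n. c n * w ^ n)" for w unfolding c_def by (rule bessel_summable)
  then have s1: "summable (\<lambda>n. diffs c n * w ^ n)" for w by (rule termdiff_converges_all)
  then have s2: "summable (\<lambda>n. diffs (diffs c) n * w ^ n)" for w by (rule termdiff_converges_all)
  have b: "bessel \<mu> = (\<lambda>w. \<Sum>n. c n * w ^ n)" by (simp add: bessel_def c_def fun_eq_iff)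
  have d1: "(bessel \<mu> has_field_derivative (\<Sum>n. diffs c n * w ^ n)) (at w)" for w
    unfolding b by (rule termdiffs_strong_converges_everywhere[OF s0])
  then have b': "deriv (bessel \<mu>) = (\<lambda>w. \<Sum>n. diffs c n * w ^ n)"
    by (auto simp: DERIV_imp_deriv)
  have d2: "(deriv (bessel \<mu>) has_field_derivative (\<Sum>n. diffs (diffs c) n * w ^ n)) (at w)" for w
    unfolding b' by (rule termdiffs_strong_converges_everywhere[OF s1])
  then have b'': "deriv (deriv (bessel \<mu>)) = (\<lambda>w. \<Sum>n. diffs (diffs c) n * w ^ n)"
    by (auto simp: DERIV_imp_deriv)
  show "bessel \<mu> holomorphic_on UNIV"
    using d1 by (auto simp: holomorphic_on_open)
  show "bessel \<mu> 0 = 1" unfolding b powser_zero by (simp add: c_def)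
  show "deriv (bessel \<mu>) 0 = \<mu>" unfolding b' powser_zero by (simp add: c_def diffs_def)
  have S1: "(\<lambda>n. diffs c n * w ^ n) sums deriv (bessel \<mu>) w"
    unfolding b' using s1 by (rule summable_sums)
  have "(\<lambda>n. w * (diffs (diffs c) n * w ^ n)) sums (w * deriv (deriv (bessel \<mu>)) w)"
    unfolding b'' using s2 by (intro sums_mult summable_sums)
  \<comment> \<open>Multiplication by \<open>w\<close> shifts the index by one; the missing term at
    index zero is zero.\<close>
  then have "(\<lambda>n. of_nat (Suc n) * diffs c (Suc n) * w ^ Suc n) sums (w * deriv (deriv (bessel \<mu>)) w)"
    by (simp add: diffs_def mult_ac)
  then have S2: "(\<lambda>n. of_nat n * diffs c n * w ^ n) sums (w * deriv (deriv (bessel \<mu>)) w)"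
    using sums_Suc_iff[of "\<lambda>n. of_nat n * diffs c n * w ^ n"] by simp
  have "diffs c n * w ^ n + of_nat n * diffs c n * w ^ n = \<mu> * (c n * w ^ n)" for n
  proof -
    have "diffs c n * of_nat (Suc n) = \<mu> * c n"
      by (simp add: diffs_def c_def power2_eq_square field_simps del: of_nat_Suc)
    moreover have "diffs c n * w ^ n + of_nat n * diffs c n * w ^ n = diffs c n * of_nat (Suc n) * w ^ n"
      by (simp add: algebra_simps)
    ultimately show ?thesis by (simp only: mult.assoc)
  qed
  with sums_add[OF S1 S2] have "(\<lambda>n. \<mu> * (c n * w ^ n)) sums (deriv (bessel \<mu>) w + w * deriv (deriv (bessel \<mu>)) w)"
    by simp
  moreover have "(\<lambda>n. \<mu> * (c n * w ^ n)) sums (\<mu> * bessel \<mu> w)"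
    unfolding b using s0 by (intro sums_mult summable_sums)
  ultimately show "deriv (bessel \<mu>) w + w * deriv (deriv (bessel \<mu>)) w = \<mu> * bessel \<mu> w"
    by (rule sums_unique2)
qed

section \<open>The solutions generated by entire densities\<close>

context schwarz_domain
begin

text \<open>The choice in \<open>lint\<close> may pick unrelated primitives for the two integrands;
  the comparison goes through contour integrals on a common path.\<close>

lemma lint_cmult:
  assumes "f holomorphic_on U" "a \<in> U" "b \<in> U"
  shows "lint U (\<lambda>t. c * f t) a b = c * lint U f a b"
proof -
  obtain g where g: "polynomial_function g" "path_image g \<subseteq> U"
      "\<And>f. f holomorphic_on U \<Longrightarrow> lint U f a b = contour_integral g f"
    using lint_obtain_path[OF assms(2,3)] by blast
  have "f contour_integrable_on g"
    using lint_eq_contour_integral[OF opn simply_conn assms(1) valid_path_polynomial_function[OF g(1)] g(2)]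
    by (rule has_contour_integral_integrable)
  then show ?thesis
    using g(3)[OF assms(1)] g(3)[OF holomorphic_on_mult[OF holomorphic_on_const assms(1)]]
    by (simp add: contour_integral_lmul)
qed

text \<open>The exponential removes the first-order terms. What remains is the mixed equation for
  \<open>v\<close>, which holds because the Riemann function satisfies it under the integral and
  both mixed derivatives are free of boundary terms.\<close>

lemma pde_solution_refl_integral:
  fixes a b c :: real
  defines "\<mu> \<equiv> of_real ((a\<^sup>2 + b\<^sup>2 - 4 * c) / 16)"
  assumes \<Phi>: "\<Phi> holomorphic_on UNIV"
  shows "pde_solution a b c U
    (\<lambda>z. exp (- of_real (a * Re z + b * Im z) / 2) * refl_integral (kern \<Phi> 0 0 (bessel \<mu>)) z)"
proof -
  define G where "G = bessel \<mu>"
  have G: "G holomorphic_on UNIV" "deriv G holomorphic_on UNIV" "deriv (deriv G) holomorphic_on UNIV"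
    using bessel_holomorphic[of \<mu>] unfolding G_def by (auto intro!: holomorphic_deriv)
  have G0: "G 0 = 1" "deriv G 0 = \<mu>" by (simp_all add: G_def bessel_0 deriv_bessel_0)
  have ode: "deriv G w + w * deriv (deriv G) w = \<mu> * G w" for w
    by (simp add: G_def bessel_ode)
  define v where "v = refl_integral (kern \<Phi> 0 0 G)"
  have mixed: "refl_integral (\<lambda>z t. kern \<Phi> 0 0 (deriv G) z t + kern \<Phi> 1 1 (deriv (deriv G)) z t) z = \<mu> * v z"
    if z: "z \<in> U" for z
  proof -
    have "kern \<Phi> 0 0 (deriv G) z t + kern \<Phi> 1 1 (deriv (deriv G)) z t = \<mu> * kern \<Phi> 0 0 G z t" for t
    proof -
      have "kern \<Phi> 0 0 (deriv G) z t + kern \<Phi> 1 1 (deriv (deriv G)) z t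
        = \<Phi> t * (deriv G ((z - t) * (cnj z - S t)) + ((z - t) * (cnj z - S t)) * deriv (deriv G) ((z - t) * (cnj z - S t)))"
        by (simp add: kern_def algebra_simps)
      then show ?thesis unfolding ode by (simp add: kern_def algebra_simps)
    qed
    then show ?thesis
      using lint_cmult[OF kern_holomorphic[OF \<Phi> G(1)] refl_in[OF z] z]
      by (simp add: refl_integral_def v_def)
  qed
  \<comment> \<open>\<open>A\<close> and \<open>B\<close> are the first derivatives of
    \<open>v\<close>, \<open>A1\<close> and \<open>B2\<close> the pure second ones. The boundary
    terms in \<open>A\<close> and \<open>B\<close> are simple because
    \<open>G 0 = 1\<close>.\<close>
  define A where "A = (\<lambda>z. refl_integral (kern \<Phi> 0 1 (deriv G)) z + \<Phi> z)"
  define B where "B = (\<lambda>z. refl_integral (kern \<Phi> 1 0 (deriv G)) z - \<Phi> (cnj (S z)) * cnj (deriv S z))"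
  define A1 where "A1 = (\<lambda>z. refl_integral (kern \<Phi> 0 2 (deriv (deriv G))) z + \<Phi> z * (cnj z - S z) * \<mu> + deriv \<Phi> z)"
  define B2 where "B2 = (\<lambda>z. refl_integral (kern \<Phi> 2 0 (deriv (deriv G))) z - \<Phi> (cnj (S z)) * (z - cnj (S z)) * \<mu> * cnj (deriv S z)
     - (\<Phi> (cnj (S z)) * cnj (deriv (deriv S) z) + deriv \<Phi> (cnj (S z)) * cnj (deriv S z) * cnj (deriv S z)))"
  have S'_hol: "deriv S holomorphic_on U" "deriv (deriv S) holomorphic_on U"
    using S_hol opn by (auto intro!: holomorphic_deriv)
  have v: "has_wirtinger v (A z) (B z) z" if z: "z \<in> U" for z
    using has_wirtinger_refl_integral_kern[OF \<Phi> G(1) z, of 0 0]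
    by (simp add: v_def A_def B_def kern_def[of \<Phi> 0 0 G z z] kern_def[of \<Phi> 0 0 G z "cnj (S z)"] S_refl[OF z] G0)
  have \<Phi>': "(\<Phi> has_field_derivative deriv \<Phi> w) (at w)" for w
    using holomorphic_derivI[OF \<Phi> open_UNIV UNIV_I] .
  \<comment> \<open>The boundary term of the mixed derivative contains \<open>cnj z - S t\<close> at
    \<open>t = cnj (S z)\<close>, which is zero by \<open>S_refl\<close>. For \<open>B\<close> it
    contains \<open>z - t\<close> at \<open>t = z\<close>.\<close>
  have A: "has_wirtinger A (A1 z) (\<mu> * v z) z" if z: "z \<in> U" for z
    using has_wirtinger_add[OF has_wirtinger_refl_integral_kern[OF \<Phi> G(2) z, of 0 1] has_wirtinger_holomorphic[OF \<Phi>'[of z]]]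
    by (simp add: A_def A1_def mixed[OF z, simplified] kern_def[of \<Phi> 0 "Suc 0" "deriv G" z z]
        kern_def[of \<Phi> 0 "Suc 0" "deriv G" z "cnj (S z)"] S_refl[OF z] G0 numeral_2_eq_2)
  have B: "has_wirtinger B (\<mu> * v z) (B2 z) z" if z: "z \<in> U" for z
  proof -
    have R: "has_wirtinger (\<lambda>z. cnj (S z)) 0 (cnj (deriv S z)) z"
      by (intro has_wirtinger_antiholomorphic holomorphic_derivI[OF S_hol opn z])
    have R': "has_wirtinger (\<lambda>z. cnj (deriv S z)) 0 (cnj (deriv (deriv S) z)) z"
      by (intro has_wirtinger_antiholomorphic holomorphic_derivI[OF S'_hol(1) opn z])
    show ?thesis
      using has_wirtinger_diff[OF has_wirtinger_refl_integral_kern[OF \<Phi> G(2) z, of 1 0]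
          has_wirtinger_mult[OF has_wirtinger_compose[OF \<Phi>' R] R']]
      by (simp add: B_def B2_def mixed[OF z, simplified] kern_def[of \<Phi> "Suc 0" 0 "deriv G" z z]
        kern_def[of \<Phi> "Suc 0" 0 "deriv G" z "cnj (S z)"] S_refl[OF z] G0 numeral_2_eq_2)
  qed
  have cv: "continuous_on U v" "continuous_on U A" "continuous_on U B"
    using v A B by (auto intro!: has_wirtinger_imp_continuous_on)
  have cr: "continuous_on U (refl_integral (kern \<Phi> m n (deriv (deriv G))))" for m n
    by (rule has_wirtinger_imp_continuous_on[OF has_wirtinger_refl_integral_kern[OF \<Phi> G(3)]])
  have cS: "continuous_on U S" "continuous_on U (deriv S)" "continuous_on U (deriv (deriv S))"
    using S_hol S'_hol by (auto intro: holomorphic_on_imp_continuous_on)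
  have c\<Phi>: "continuous_on V \<Phi>" "continuous_on V (deriv \<Phi>)" for V
    using \<Phi> holomorphic_deriv[OF \<Phi>]
    by (auto intro!: holomorphic_on_imp_continuous_on elim: holomorphic_on_subset)
  have c\<Phi>R: "continuous_on U (\<lambda>z. \<Phi> (cnj (S z)))" "continuous_on U (\<lambda>z. deriv \<Phi> (cnj (S z)))"
    by (auto intro!: continuous_on_compose2[OF c\<Phi>(1)[of UNIV]] continuous_on_compose2[OF c\<Phi>(2)[of UNIV]] continuous_intros cS)
  have cA1: "continuous_on U A1" unfolding A1_def by (intro continuous_intros cr cS c\<Phi>)
  have cB2: "continuous_on U B2" unfolding B2_def by (intro continuous_intros cr cS c\<Phi> c\<Phi>R)
  \<comment> \<open>Chosen so that twice the real part of \<open>e * z\<close> is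
    \<open>- (a * x + b * y) / 2\<close>.\<close>
  define e where "e = - Complex a (- b) / 4"
  define E where "E = (\<lambda>z. exp (e * z + cnj e * cnj z))"
  have Eeq: "exp (- of_real (a * Re z + b * Im z) / 2) = E z" for z
  proof -
    have "- of_real (a * Re z + b * Im z) / 2 = e * z + cnj e * cnj z"
      by (simp add: complex_eq_iff e_def field_simps)
    then show ?thesis unfolding E_def by (rule arg_cong)
  qed
  have E: "has_wirtinger E (e * E z) (cnj e * E z) z" for z
  proof -
    have "has_wirtinger cnj 0 1 z" using has_wirtinger_antiholomorphic[OF DERIV_ident] by simp
    from has_wirtinger_add[OF has_wirtinger_cmult[OF has_wirtinger_holomorphic[OF DERIV_ident], of e] has_wirtinger_cmult[OF this, of "cnj e"]]
    have "has_wirtinger (\<lambda>z. e * z + cnj e * cnj z) e (cnj e) z" by simp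
    from has_wirtinger_compose[OF DERIV_exp this] show ?thesis by (simp add: E_def mult.commute)
  qed
  have cE: "continuous_on U E" by (rule has_wirtinger_imp_continuous_on[OF E])
  \<comment> \<open>After the product rule these are the coefficients of \<open>v\<close> and of its
    two first derivatives: \<open>e\<close> makes the latter vanish, and the value of
    \<open>\<mu>\<close> then the former.\<close>
  have eqn: "4 * e * cnj e + (of_real a + \<i> * of_real b) * e + (of_real a - \<i> * of_real b) * cnj e + 4 * \<mu> + of_real c = 0"
    by (simp add: complex_eq_iff e_def \<mu>_def field_simps power2_eq_square)
  have ee: "4 * cnj e + (of_real a + \<i> * of_real b) = 0" "4 * e + (of_real a - \<i> * of_real b) = 0"
    by (simp_all add: complex_eq_iff e_def)
  have "pde_solution a b c U (\<lambda>z. E z * v z)"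
  proof (rule has_wirtinger_imp_pde_solution[OF opn])
    fix z assume z: "z \<in> U"
    show "has_wirtinger (\<lambda>z. E z * v z) (E z * A z + e * E z * v z) (E z * B z + cnj e * E z * v z) z"
      by (rule has_wirtinger_mult[OF E v[OF z]])
    show "has_wirtinger (\<lambda>z. E z * A z + e * E z * v z)
        ((E z * A1 z + e * E z * A z) + (e * E z * A z + e * (e * E z) * v z))
        ((E z * (\<mu> * v z) + cnj e * E z * A z) + (e * E z * B z + e * (cnj e * E z) * v z)) z"
      by (intro has_wirtinger_add has_wirtinger_mult has_wirtinger_cmult E v A z)
    show "has_wirtinger (\<lambda>z. E z * B z + cnj e * E z * v z)
        ((E z * (\<mu> * v z) + e * E z * B z) + (cnj e * E z * A z + cnj e * (e * E z) * v z))
        ((E z * B2 z + cnj e * E z * B z) + (cnj e * E z * B z + cnj e * (cnj e * E z) * v z)) z"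
      by (intro has_wirtinger_add has_wirtinger_mult has_wirtinger_cmult E v B z)
    have "2 * (((E z * (\<mu> * v z) + cnj e * E z * A z) + (e * E z * B z + e * (cnj e * E z) * v z))
          + ((E z * (\<mu> * v z) + e * E z * B z) + (cnj e * E z * A z + cnj e * (e * E z) * v z)))
        + (of_real a + \<i> * of_real b) * (E z * A z + e * E z * v z)
        + (of_real a - \<i> * of_real b) * (E z * B z + cnj e * E z * v z) + of_real c * (E z * v z)
      = E z * v z * (4 * e * cnj e + (of_real a + \<i> * of_real b) * e + (of_real a - \<i> * of_real b) * cnj e + 4 * \<mu> + of_real c)
        + E z * A z * (4 * cnj e + (of_real a + \<i> * of_real b)) + E z * B z * (4 * e + (of_real a - \<i> * of_real b))"
      by (simp add: algebra_simps)
    also have "\<dots> = 0" unfolding eqn ee by simp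
    finally show "2 * (((E z * (\<mu> * v z) + cnj e * E z * A z) + (e * E z * B z + e * (cnj e * E z) * v z))
          + ((E z * (\<mu> * v z) + e * E z * B z) + (cnj e * E z * A z + cnj e * (e * E z) * v z)))
        + (of_real a + \<i> * of_real b) * (E z * A z + e * E z * v z)
        + (of_real a - \<i> * of_real b) * (E z * B z + cnj e * E z * v z) + of_real c * (E z * v z) = 0" .
  qed (intro continuous_intros cE cv cA1 cB2)+
  then show ?thesis by (simp only: Eeq v_def G_def)
qed

end

section \<open>Consequences of point-to-point reflection\<close>

text \<open>Densities have to be entire, whereas the approximation theorem yields polynomials on an
  interval; the same coefficients serve at complex arguments.\<close>

lemma polynomial_function_extends_entire:
  fixes g :: "real \<Rightarrow> complex"
  assumes "polynomial_function g"
  obtains \<Phi> where "\<Phi> holomorphic_on UNIV" "\<And>x. \<Phi> (of_real x) = g x"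
proof -
  have "real_polynomial_function (Re \<circ> g)" "real_polynomial_function (Im \<circ> g)"
    using assms bounded_linear_Re bounded_linear_Im unfolding polynomial_function_def by blast+
  then obtain a m b n where ab: "Re \<circ> g = (\<lambda>x. \<Sum>i\<le>m. a i * x ^ i)" "Im \<circ> g = (\<lambda>x. \<Sum>i\<le>n. b i * x ^ i)"
    unfolding real_polynomial_function_iff_sum by metis
  define \<Phi> where "\<Phi> = (\<lambda>w::complex. (\<Sum>i\<le>m. of_real (a i) * w ^ i) + \<i> * (\<Sum>i\<le>n. of_real (b i) * w ^ i))"
  show ?thesis
  proof
    show "\<Phi> holomorphic_on UNIV" unfolding \<Phi>_def by (intro holomorphic_intros)
    fix x
    have "Re (g x) = (\<Sum>i\<le>m. a i * x ^ i)" "Im (g x) = (\<Sum>i\<le>n. b i * x ^ i)"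
      using ab by (auto simp: fun_eq_iff)
    moreover have "\<Phi> (of_real x) = of_real (\<Sum>i\<le>m. a i * x ^ i) + \<i> * of_real (\<Sum>i\<le>n. b i * x ^ i)"
      by (simp add: \<Phi>_def)
    ultimately show "\<Phi> (of_real x) = g x"
      by (simp add: complex_eq_iff)
  qed
qed

text \<open>Approximating \<open>cnj h\<close> within \<open>e\<close> by a polynomial
  \<open>g\<close> leaves the integral of \<open>(norm h)\<^sup>2\<close> equal to that of
  \<open>(cnj h - g) * h\<close>, which is at most \<open>e * M\<close> in norm.\<close>

lemma continuous_orthogonal_polynomials_zero:
  fixes h :: "real \<Rightarrow> complex"
  assumes h: "continuous_on {0..1} h"
    and orth: "\<And>g. polynomial_function g \<Longrightarrow> integral {0..1} (\<lambda>x. g x * h x) = 0"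
    and x: "x \<in> {0..1}"
  shows "h x = 0"
proof -
  have "bounded (h ` {0..1})"
    using compact_imp_bounded[OF compact_continuous_image[OF h compact_Icc]] .
  then obtain M where M: "M > 0" "\<And>x. x \<in> {0..1} \<Longrightarrow> norm (h x) \<le> M"
    unfolding bounded_pos by auto
  define J where "J = integral {0..1} (\<lambda>x. cnj (h x) * h x)"
  have "norm J \<le> e * M" if e: "e > 0" for e
  proof -
    obtain g where g: "polynomial_function g" "\<And>x. x \<in> {0..1} \<Longrightarrow> norm (cnj (h x) - g x) < e"
      using Stone_Weierstrass_polynomial_function[OF compact_Icc continuous_on_cnj[OF h] e] by blast
    have cg: "continuous_on {0..1} g" by (rule continuous_on_polymonial_function[OF g(1)])
    have i1: "(\<lambda>x. cnj (h x) * h x) integrable_on {0..1}" "(\<lambda>x. g x * h x) integrable_on {0..1}"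
      "(\<lambda>x. (cnj (h x) - g x) * h x) integrable_on {0..1}"
      by (intro integrable_continuous_interval continuous_intros h cg)+
    have "J = integral {0..1} (\<lambda>x. cnj (h x) * h x - g x * h x)"
      unfolding J_def using orth[OF g(1)] by (simp add: integral_diff[OF i1(1,2)])
    also have "\<dots> = integral {0..1} (\<lambda>x. (cnj (h x) - g x) * h x)"
      by (simp add: algebra_simps)
    finally have "norm J = norm (integral {0..1} (\<lambda>x. (cnj (h x) - g x) * h x))" by simp
    also have "\<dots> \<le> (e * M) * (1 - 0)"
    proof (rule integral_bound)
      show "continuous_on {0..1} (\<lambda>x. (cnj (h x) - g x) * h x)" by (intro continuous_intros h cg)
      show "norm ((cnj (h x) - g x) * h x) \<le> e * M" if "x \<in> {0..1}" for x
        unfolding norm_mult using g(2)[OF that] M(2)[OF that] \<open>e > 0\<close> by (intro mult_mono) auto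
    qed simp
    finally show ?thesis by simp
  qed
  from this[of "e / M" for e] have "norm J \<le> e" if "e > 0" for e
    using that M(1) by (metis divide_pos_pos nonzero_divide_eq_eq less_irrefl)
  then have J0: "J = 0" using field_le_epsilon[of "norm J" 0] by simp
  have "cnj (h x) * h x = of_real ((norm (h x))\<^sup>2)" for x
    by (metis complex_norm_square mult.commute)
  then have "J = integral {0..1} (\<lambda>x. of_real ((norm (h x))\<^sup>2))" by (simp add: J_def)
  also have "\<dots> = of_real (integral {0..1} (\<lambda>x. (norm (h x))\<^sup>2))"
  proof -
    have "(\<lambda>x. (norm (h x))\<^sup>2) integrable_on {0..1}"
      by (intro integrable_continuous_interval continuous_intros h)
    from integral_linear[OF this bounded_linear_of_real] show ?thesis by (simp add: o_def)
  qed
  finally have "integral {0..1} (\<lambda>x. (norm (h x))\<^sup>2) = 0" using J0 by simp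
  moreover have "continuous_on {0..1} (\<lambda>x. (norm (h x))\<^sup>2)" by (intro continuous_intros h)
  ultimately have "\<forall>x\<in>{0..1}. (norm (h x))\<^sup>2 = 0" by (subst (asm) integral_eq_0_iff) auto
  then show ?thesis using x by simp
qed

lemma contour_orthogonal_entire_zero:
  assumes ne: "p \<noteq> q" and h: "continuous_on (closed_segment p q) h"
    and orth: "\<And>\<Phi>. \<Phi> holomorphic_on UNIV \<Longrightarrow> contour_integral (linepath p q) (\<lambda>t. \<Phi> t * h t) = 0"
    and t: "t \<in> closed_segment p q"
  shows "h t = 0"
proof -
  obtain x where x: "x \<in> {0..1}" "t = linepath p q x"
    using t unfolding path_image_linepath[symmetric] path_image_def by blast
  have "h (linepath p q x) = 0"
  proof (rule continuous_orthogonal_polynomials_zero[where h = "\<lambda>x. h (linepath p q x)", OF _ _ x(1)])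
    show "continuous_on {0..1} (\<lambda>x. h (linepath p q x))"
      by (rule continuous_on_compose2[OF h continuous_on_linepath])
         (auto simp: linepath_in_path)
    fix g :: "real \<Rightarrow> complex" assume "polynomial_function g"
    then obtain \<Phi> where \<Phi>: "\<Phi> holomorphic_on UNIV" "\<And>x. \<Phi> (of_real x) = g x"
      by (rule polynomial_function_extends_entire) blast
    \<comment> \<open>The affine map sends the segment back to the unit interval, so
      \<open>\<Psi>\<close> restricts to \<open>g\<close> along the path.\<close>
    define \<Psi> where "\<Psi> = (\<lambda>w. \<Phi> ((w - p) / (q - p)))"
    have \<Psi>: "\<Psi> holomorphic_on UNIV"
      unfolding \<Psi>_def using ne
      by (intro holomorphic_on_compose_gen[OF _ \<Phi>(1), unfolded o_def] holomorphic_intros) auto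
    have "\<Psi> (linepath p q x) = g x" for x
    proof -
      have "(linepath p q x - p) / (q - p) = of_real x"
        using ne by (simp add: linepath_def scaleR_conv_of_real field_simps)
      then show ?thesis by (simp add: \<Psi>_def \<Phi>(2))
    qed
    then have "0 = integral {0..1} (\<lambda>x. g x * h (linepath p q x) * (q - p))"
      using orth[OF \<Psi>] by (simp add: contour_integral_integral)
    then show "integral {0..1} (\<lambda>x. g x * h (linepath p q x)) = 0"
      using ne by (simp add: integral_mult_left)
  qed
  then show ?thesis using x(2) by simp
qed

section \<open>The functional equation and the affine Schwarz function\<close>

context schwarz_domain
begin

text \<open>For the constructed solutions the reflection law says that a fixed holomorphic
  \<open>h\<close> is orthogonal to every density on the segment, so \<open>h\<close> vanishes
  there. The unknown \<open>\<kappa>\<close> is eliminated by evaluating at one end point.\<close>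

lemma point_reflection_imp_bessel_eq:
  fixes a b c :: real
  defines "\<mu> \<equiv> of_real ((a\<^sup>2 + b\<^sup>2 - 4 * c) / 16)"
  assumes P: "P \<in> U" and ne: "cnj (S P) \<noteq> P" and seg: "closed_segment (cnj (S P)) P \<subseteq> U"
    and \<kappa>: "\<And>u. pde_solution a b c U u \<Longrightarrow> (\<And>z. z \<in> U \<Longrightarrow> S z = cnj z \<Longrightarrow> u z = 0) \<Longrightarrow> u P = \<kappa> * u (cnj (S P))"
    and t: "t \<in> closed_segment (cnj (S P)) P"
  shows "bessel \<mu> ((P - t) * (cnj P - S t)) = bessel \<mu> ((cnj (S P) - t) * (S P - S t))"
proof -
  define Q where "Q = cnj (S P)"
  define E where "E = (\<lambda>z. exp (- complex_of_real (a * Re z + b * Im z) / 2))"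
  define G where "G = (\<lambda>z t. bessel \<mu> ((z - t) * (cnj z - S t)))"
  have QU: "Q \<in> U" using refl_in[OF P] by (simp add: Q_def)
  have SQ: "S Q = cnj P" using S_refl[OF P] by (simp add: Q_def)
  have Ghol: "G z holomorphic_on U" for z
    using kern_holomorphic[of "\<lambda>_. 1" "bessel \<mu>" 0 0 z] bessel_holomorphic[of \<mu>]
    by (simp add: G_def kern_def[abs_def])
  \<comment> \<open>The sign is plus because the integral for \<open>Q\<close> runs from
    \<open>P\<close> to \<open>Q\<close>, against the orientation used for \<open>P\<close>.\<close>
  define h where "h = (\<lambda>t. E P * G P t + \<kappa> * E Q * G Q t)"
  have hhol: "h holomorphic_on U" unfolding h_def by (intro holomorphic_intros Ghol)
  have orth: "contour_integral (linepath Q P) (\<lambda>t. \<Phi> t * h t) = 0" if \<Phi>: "\<Phi> holomorphic_on UNIV" for \<Phi>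
  proof -
    have \<Phi>U: "\<Phi> holomorphic_on U" using \<Phi> holomorphic_on_subset by blast
    define k where "k = kern \<Phi> 0 0 (bessel \<mu>)"
    have k: "k z = (\<lambda>t. \<Phi> t * G z t)" for z by (simp add: k_def kern_def G_def fun_eq_iff)
    define u where "u = (\<lambda>z. E z * refl_integral k z)"
    have "pde_solution a b c U u"
      unfolding u_def E_def k_def \<mu>_def by (rule pde_solution_refl_integral[OF \<Phi>])
    then have "u P = \<kappa> * u Q"
      unfolding Q_def by (rule \<kappa>) (simp add: u_def refl_integral_def)
    moreover have I: "((\<lambda>t. \<Phi> t * G z t) has_contour_integral lint U (k z) Q P) (linepath Q P)" for z
      using lint_eq_contour_integral[OF opn simply_conn _ valid_path_linepath, of "k z" Q P] seg
        holomorphic_on_mult[OF \<Phi>U Ghol[of z]] by (simp add: k Q_def)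
    moreover have "refl_integral k P = lint U (k P) Q P" by (simp add: refl_integral_def Q_def)
    moreover have "refl_integral k Q = - lint U (k Q) Q P"
      using lint_combine[of U "k Q" P Q P] by (simp add: refl_integral_def SQ add_eq_0_iff2)
    ultimately have "E P * lint U (k P) Q P + \<kappa> * E Q * lint U (k Q) Q P = 0"
      by (simp add: u_def)
    moreover have "((\<lambda>t. E P * (\<Phi> t * G P t) + \<kappa> * E Q * (\<Phi> t * G Q t)) has_contour_integral
        E P * lint U (k P) Q P + \<kappa> * E Q * lint U (k Q) Q P) (linepath Q P)"
      by (intro has_contour_integral_add has_contour_integral_lmul I)
    moreover have "(\<lambda>t. E P * (\<Phi> t * G P t) + \<kappa> * E Q * (\<Phi> t * G Q t)) = (\<lambda>t. \<Phi> t * h t)"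
      by (simp add: h_def fun_eq_iff algebra_simps)
    ultimately show ?thesis by (simp add: contour_integral_unique)
  qed
  have hz: "h t = 0" if "t \<in> closed_segment Q P" for t
    by (rule contour_orthogonal_entire_zero[OF _ _ orth that])
       (use ne seg holomorphic_on_imp_continuous_on[OF hhol] in \<open>auto simp: Q_def elim: continuous_on_subset\<close>)
  \<comment> \<open>At \<open>t = Q\<close> both Riemann functions have argument zero, one through
    \<open>S Q = cnj P\<close> and one through \<open>Q - t\<close>, so both equal one.\<close>
  have "h Q = E P + \<kappa> * E Q"
    by (simp add: h_def G_def SQ bessel_0)
  then have \<kappa>E: "\<kappa> * E Q = - E P" using hz[of Q] by (simp add: add_eq_0_iff2)
  have "E P * (G P t - G Q t) = 0"
    using hz[of t] t unfolding h_def \<kappa>E by (simp add: Q_def algebra_simps)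
  then show ?thesis by (simp add: E_def G_def Q_def)
qed

text \<open>The arguments have norm below \<open>2 * d * 2\<close>, hence lie in the ball of
  injectivity and are equal. On expanding them the products \<open>t * S t\<close> cancel and an
  affine relation is left.\<close>

lemma bessel_eq_imp_affine_on_segment:
  assumes inj: "inj_on (bessel \<mu>) (ball 0 r)" and d: "4 * d \<le> r"
    and near: "\<And>z. z \<in> ball p d \<Longrightarrow> dist (S z) (cnj p) < 1" and d1: "d \<le> 1"
    and P: "P \<in> U" "P \<in> ball p d" and Q: "Q = cnj (S P)" "Q \<in> ball p d"
    and eq: "bessel \<mu> ((P - t) * (cnj P - S t)) = bessel \<mu> ((Q - t) * (S P - S t))"
    and t: "t \<in> ball p d"
  shows "(Q - P) * S t - (Q * S P - P * S Q + t * (S Q - S P)) = 0"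
proof -
  have SQ: "S Q = cnj P" using S_refl[OF P(1)] by (simp add: Q(1))
  have "d > 0" using t by (metis ball_eq_empty empty_iff not_le)
  have small: "(x - t) * (S y - S t) \<in> ball 0 r" if "x \<in> ball p d" "y \<in> ball p d" for x y
  proof -
    have "dist x t < 2 * d" using that(1) t dist_triangle2[of x t p] by (simp add: dist_commute)
    moreover have "dist (S y) (S t) < 2"
      using near[OF that(2)] near[OF t] dist_triangle2[of "S y" "S t" "cnj p"] by simp
    ultimately have "norm (x - t) * norm (S y - S t) < 2 * d * 2"
      using \<open>d > 0\<close> by (intro mult_strict_mono) (auto simp: dist_norm)
    then show ?thesis using d by (simp add: norm_mult)
  qed
  have "(P - t) * (S Q - S t) = (Q - t) * (S P - S t)"
    using inj_onD[OF inj eq[folded SQ] small small] P Q t by simp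
  then show ?thesis by (simp add: algebra_simps)
qed

end

section \<open>From an affine Schwarz function to a straight curve\<close>

text \<open>If \<open>f\<close> vanished on a disc about \<open>p\<close>, its gradient at
  \<open>p\<close> would be zero. This supplies a point \<open>P\<close> off the curve arbitrarily
  close to it.\<close>

lemma nonsingular_curve_no_interior:
  assumes "nonsingular_analytic_curve f W \<Gamma>" "p \<in> \<Gamma>" "d > 0"
  obtains P where "P \<in> ball p d" "P \<notin> \<Gamma>"
proof (rule ccontr)
  assume "\<not> thesis"
  then have sub: "ball p d \<subseteq> \<Gamma>" using that by blast
  have z: "f z = 0" if "z \<in> ball p d" for z
    using that sub assms(1) by (auto simp: nonsingular_analytic_curve_def)
  have "((\<lambda>t::real. f (p + w * of_real t)) has_vector_derivative 0) (at 0)" if w: "norm w = 1" for w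
  proof (rule has_vector_derivative_transform_within_open)
    show "((\<lambda>t::real. 0) has_vector_derivative (0::real)) (at 0)" by simp
    show "0 = f (p + w * of_real t)" if "t \<in> ball 0 d" for t
      using that w by (intro z[symmetric]) (simp add: dist_norm norm_mult)
  qed (use assms(3) in auto)
  from this[of 1] this[of \<i>] have "pdx f p = 0" "pdy f p = 0"
    by (auto simp: pdx_def pdy_def vector_derivative_at)
  then show False using assms(1,2) by (auto simp: nonsingular_analytic_curve_def)
qed

text \<open>After subtracting the relation at \<open>p\<close>, conjugation acts on all differences
  \<open>z - p\<close> as multiplication by one constant, so the quotient of two of them is
  real.\<close>

lemma reflected_multiple_imp_line:
  assumes S: "\<And>z. z \<in> X \<Longrightarrow> A * cnj z = B + z * C" and "A \<noteq> 0" and p: "p \<in> X"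
  obtains \<tau> where "norm \<tau> = 1" "\<And>z. z \<in> X \<Longrightarrow> \<exists>s. z = p + of_real s * \<tau>"
proof (cases "\<exists>z\<in>X. z \<noteq> p")
  case True
  then obtain z0 where z0: "z0 \<in> X" "z0 \<noteq> p" by blast
  have eq: "A * cnj (z - p) = C * (z - p)" if "z \<in> X" for z
    using S[OF that] S[OF p] by (simp add: algebra_simps)
  show ?thesis
  proof (rule that[of "(z0 - p) / of_real (norm (z0 - p))"])
    show "norm ((z0 - p) / of_real (norm (z0 - p))) = 1"
      using z0 by (simp add: norm_divide)
    fix z assume z: "z \<in> X"
    define w where "w = (z - p) / (z0 - p)"
    have "A * (cnj (z - p) * (z0 - p)) = (A * cnj (z - p)) * (z0 - p)"
      by (simp only: mult.assoc)
    also have "\<dots> = (z - p) * (A * cnj (z0 - p))"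
      unfolding eq[OF z] eq[OF z0(1)] by (simp only: mult_ac)
    also have "\<dots> = A * ((z - p) * cnj (z0 - p))"
      by (simp only: mult_ac)
    finally have "cnj (z - p) * (z0 - p) = (z - p) * cnj (z0 - p)"
      by (rule mult_left_cancel[OF \<open>A \<noteq> 0\<close>, THEN iffD1])
    then have "cnj w = w" using z0 by (simp add: w_def field_simps)
    then have "w = of_real (Re w)" by (simp add: complex_eq_iff)
    moreover have "z - p = w * (z0 - p)" using z0 by (simp add: w_def)
    ultimately have "z - p = of_real (Re w) * (z0 - p)" by simp
    moreover have "of_real (Re w * norm (z0 - p)) * ((z0 - p) / of_real (norm (z0 - p))) = of_real (Re w) * (z0 - p)"
      using z0 by simp
    ultimately have "z = p + of_real (Re w * norm (z0 - p)) * ((z0 - p) / of_real (norm (z0 - p)))"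
      by (simp only:) (simp add: algebra_simps)
    then show "\<exists>s. z = p + of_real s * ((z0 - p) / of_real (norm (z0 - p)))" by blast
  qed
next
  case False
  \<comment> \<open>Here \<open>X\<close> is the single point \<open>p\<close>, and any unit
    direction will do.\<close>
  then show ?thesis by (intro that[of 1]) (auto intro: exI[of _ 0])
qed

theorem theorem5p1:
  fixes a b c :: real
    and f :: "complex \<Rightarrow> real"
    and W \<Gamma> U U\<^sub>1 U\<^sub>2 :: "complex set"
    and S R :: "complex \<Rightarrow> complex"
  assumes "nonsingular_analytic_curve f W \<Gamma>"
    and "connected \<Gamma>"
    and "reflection_neighbourhood f \<Gamma> U U\<^sub>1 U\<^sub>2 S R"
    and "point_to_point_reflection a b c \<Gamma> U R"
  shows "collinear \<Gamma> \<or> a\<^sup>2 + b\<^sup>2 - 4 * c = 0"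
proof (cases "a\<^sup>2 + b\<^sup>2 - 4 * c = 0")
  case False
  have U: "open U" "simply_connected U" "S holomorphic_on U" "\<Gamma> \<inter> U \<noteq> {}"
    and comp: "U\<^sub>1 \<noteq> U\<^sub>2" "components (U - \<Gamma>) = {U\<^sub>1, U\<^sub>2}" "R ` U\<^sub>1 = U\<^sub>2" "R ` U\<^sub>2 = U\<^sub>1"
    and R: "\<And>z. z \<in> U \<Longrightarrow> R z = cnj (S z)"
    and S\<Gamma>: "\<And>z. z \<in> \<Gamma> \<inter> U \<Longrightarrow> S z = cnj z"
    using assms(3) by (simp_all add: reflection_neighbourhood_def schwarz_function_def)
  have "\<forall>z\<in>U. R z \<in> U \<and> R (R z) = z"
    using assms(3) unfolding reflection_neighbourhood_def by (elim conjE) assumption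
  then have RU: "\<And>z. z \<in> U \<Longrightarrow> R z \<in> U" "\<And>z. z \<in> U \<Longrightarrow> R (R z) = z" by blast+
  interpret schwarz_domain U S
  proof
    show "cnj (S z) \<in> U" "S (cnj (S z)) = cnj z" if "z \<in> U" for z
      using RU[OF that] R[OF that] R[OF RU(1)[OF that]] by (simp, metis complex_cnj_cnj)
  qed (use U in auto)
  define \<mu> :: complex where "\<mu> = of_real ((a\<^sup>2 + b\<^sup>2 - 4 * c) / 16)"
  have "\<mu> \<noteq> 0" unfolding \<mu>_def of_real_eq_0_iff using False by simp
  then have "deriv (bessel \<mu>) 0 \<noteq> 0" by (simp add: deriv_bessel_0)
  then obtain r where r: "r > 0" "inj_on (bessel \<mu>) (ball 0 r)"
    using has_complex_derivative_locally_injective[OF bessel_holomorphic UNIV_I open_UNIV] by metis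
  obtain p where p: "p \<in> \<Gamma>" "p \<in> U" using U(4) by blast
  have Sp: "S p = cnj p" using S\<Gamma> p by blast
  have cS: "isCont S p"
    using holomorphic_on_imp_continuous_on[OF S_hol] continuous_on_eq_continuous_at[OF opn] p(2) by blast
  obtain d0 where d0: "d0 > 0" "ball p d0 \<subseteq> U" using opn p(2) openE by blast
  obtain d2 where d2: "d2 > 0" "\<And>z. dist z p < d2 \<Longrightarrow> dist (S z) (S p) < 1"
    using cS unfolding continuous_at_eps_delta by (meson zero_less_one)
  \<comment> \<open>The disc must lie in \<open>U\<close>, keep \<open>S\<close> within distance one
    of \<open>cnj p\<close>, and be small enough for the arguments of the Riemann function to stay
    in the ball of injectivity.\<close>
  define d where "d = min (min d0 d2) (min 1 (r / 4))"
  have d: "d > 0" "d \<le> d0" "d \<le> d2" "d \<le> 1" "4 * d \<le> r"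
    using d0(1) d2(1) r(1) by (auto simp: d_def)
  have dU: "ball p d \<subseteq> U" using d(2) d0(2) by auto
  \<comment> \<open>Conjugation is an isometry and \<open>S p = cnj p\<close>, so \<open>P\<close>
    within \<open>d3\<close> of \<open>p\<close> forces its reflection \<open>Q\<close> into the
    disc of radius \<open>d\<close>.\<close>
  obtain d3 where d3: "d3 > 0" "\<And>z. dist z p < d3 \<Longrightarrow> dist (S z) (S p) < d"
    using cS d(1) unfolding continuous_at_eps_delta by meson
  obtain P where P: "P \<in> ball p (min d d3)" "P \<notin> \<Gamma>"
    using nonsingular_curve_no_interior[OF assms(1) p(1)] d(1) d3(1) by (metis min_less_iff_conj)
  have Pd: "P \<in> ball p d" and PU: "P \<in> U" using P(1) dU by auto
  define Q where "Q = cnj (S P)"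
  have Qd: "Q \<in> ball p d"
  proof -
    have "dist Q p = dist (S P) (S p)"
      unfolding Q_def Sp dist_norm by (metis complex_cnj_cnj complex_cnj_diff complex_mod_cnj)
    then show ?thesis using d3(2)[of P] P(1) by (simp add: dist_commute)
  qed
  have "P \<in> \<Union> (components (U - \<Gamma>))" using PU P(2) by simp
  then have P12: "P \<in> U\<^sub>1 \<or> P \<in> U\<^sub>2" using comp(2) by simp
  have disj: "U\<^sub>1 \<inter> U\<^sub>2 = {}"
    using components_nonoverlap[of U\<^sub>1 "U - \<Gamma>" U\<^sub>2] comp(1,2) by simp
  \<comment> \<open>The reflection exchanges two disjoint components, so a point off the curve is
    moved and the segment from \<open>Q\<close> to \<open>P\<close> is nondegenerate.\<close>
  have "R P \<noteq> P"
    using P12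
  proof
    assume "P \<in> U\<^sub>1"
    moreover from this have "R P \<in> U\<^sub>2" unfolding comp(3)[symmetric] by (rule imageI)
    ultimately show ?thesis using disj by auto
  next
    assume "P \<in> U\<^sub>2"
    moreover from this have "R P \<in> U\<^sub>1" unfolding comp(4)[symmetric] by (rule imageI)
    ultimately show ?thesis using disj by auto
  qed
  then have QP: "Q \<noteq> P" by (simp add: R[OF PU] Q_def)
  have segd: "closed_segment Q P \<subseteq> ball p d"
    using Qd Pd by (simp add: closed_segment_subset)
  obtain \<kappa> where "\<And>P u. P \<in> U - \<Gamma> \<Longrightarrow> pde_solution a b c U u \<Longrightarrow> (\<And>z. z \<in> \<Gamma> \<inter> U \<Longrightarrow> u z = 0) \<Longrightarrow> u P = \<kappa> P * u (R P)"
    using assms(4) unfolding point_to_point_reflection_def by blast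
  from this[of P] have \<kappa>: "u P = \<kappa> P * u (cnj (S P))"
    if "pde_solution a b c U u" "\<And>z. z \<in> U \<Longrightarrow> S z = cnj z \<Longrightarrow> u z = 0" for u
    using that S\<Gamma> PU P(2) by (simp add: R)
  have aff: "(Q - P) * S t - (Q * S P - P * S Q + t * (S Q - S P)) = 0" if t: "t \<in> closed_segment Q P" for t
  proof (rule bessel_eq_imp_affine_on_segment[OF r(2) d(5) _ d(4) PU Pd Q_def Qd])
    show "dist (S z) (cnj p) < 1" if "z \<in> ball p d" for z
      using d2(2)[of z] that d(3) by (simp add: Sp dist_commute)
    show "bessel \<mu> ((P - t) * (cnj P - S t)) = bessel \<mu> ((Q - t) * (S P - S t))"
      unfolding \<mu>_def Q_def
      by (rule point_reflection_imp_bessel_eq[where \<kappa> = "\<kappa> P", OF PU _ _ \<kappa>])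
         (use QP segd dU t in \<open>auto simp: Q_def\<close>)
    show "t \<in> ball p d" using t segd by blast
  qed
  have lim: "P islimpt closed_segment Q P"
  proof (rule connected_imp_perfect)
    fix x show "closed_segment Q P \<noteq> {x}" using QP by (metis ends_in_segment singletonD)
  qed auto
  \<comment> \<open>Identity theorem: the relation holds on a segment accumulating at
    \<open>P\<close>, hence on the whole disc, which contains \<open>p\<close> and an arc of the
    curve.\<close>
  have affb: "(Q - P) * S t - (Q * S P - P * S Q + t * (S Q - S P)) = 0" if t: "t \<in> ball p d" for t
  proof (rule analytic_continuation[OF _ open_ball connected_ball segd Pd lim aff t])
    have "S holomorphic_on ball p d" using S_hol dU holomorphic_on_subset by blast
    then show "(\<lambda>t. (Q - P) * S t - (Q * S P - P * S Q + t * (S Q - S P))) holomorphic_on ball p d"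
      by (intro holomorphic_intros)
  qed
  \<comment> \<open>On the curve \<open>S z = cnj z\<close> turns the formula for \<open>S\<close>
    into an equation for the points of the curve themselves.\<close>
  have "(Q - P) * cnj z = (Q * S P - P * S Q) + z * (S Q - S P)" if "z \<in> \<Gamma> \<inter> ball p d" for z
    using affb[of z] S\<Gamma>[of z] that dU by auto
  then obtain \<tau> where \<tau>: "norm \<tau> = 1" "\<And>z. z \<in> \<Gamma> \<inter> ball p d \<Longrightarrow> \<exists>s. z = p + of_real s * \<tau>"
    using reflected_multiple_imp_line[of "\<Gamma> \<inter> ball p d" "Q - P" _ _ p] QP p(1) d(1) by (metis IntI centre_in_ball right_minus_eq)
  have "collinear \<Gamma>"
  proof (rule analytic_curve_locally_line_imp_collinear[OF assms(1,2) p(1) \<tau>(1)])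
    have "\<forall>\<^sub>F z in nhds p. z \<in> ball p d" using d(1) by (intro eventually_nhds_in_open) auto
    then show "\<forall>\<^sub>F z in nhds p. z \<in> \<Gamma> \<longrightarrow> (\<exists>s. z = p + of_real s * \<tau>)"
      by (rule eventually_mono) (use \<tau>(2) in blast)
  qed
  then show ?thesis ..
qed simp

end
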